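(* Let $n>1$, $d\ge 2$ and $t$ be integers with $\gcd(t,d)=1$, $n\equiv t\pmod d$ and $n+d-nd\le t\le n$. Then \[ \sum_{k=0}^{(n-t)/d}[2dk+t]\frac{(q^t;q^d)_k^4}{(q^d;q^d)_k^4}q^{(d-2t)k}\equiv \frac{(q^{2t};q^d)_{(n-t)/d}}{(q^d;q^d)_{(n-t)/d}}[n]\,q^{t(t-n)/d}\pmod{[n]\Phi_n(q)^2}, \] and \[ \sum_{k=0}^{n-1}[2dk+t]\frac{(q^t;q^d)_k^4}{(q^d;q^d)_k^4}q^{(d-2t)k}\equiv \frac{(q^{2t};q^d)_{(n-t)/d}}{(q^d;q^d)_{(n-t)/d}}[n]\,q^{t(t-n)/d}\pmod{[n]\Phi_n(q)^2}. \]
   Context: For an indeterminate $q$, $(x;q)_k=(1-x)(1-xq)\cdots(1-xq^{k-1})$ (with $(x;q)_0=1$). For any integer $m$, $[m]=(1-q^m)/(1-q)$. $\Phi_n(q)$ is the $n$-th cyclotomic polynomial. A congruence $A\equiv B\pmod{P(q)}$ between rational functions in $q$ means that $A-B$, written as a quotient of polynomials with denominator coprime to $P(q)$, has numerator divisible by $P(q)$. *)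

theory Defs
  imports "HOL-Computational_Algebra.Computational_Algebra" "HOL-Number_Theory.Cong"
begin

function cyclotomic :: "nat \<Rightarrow> rat poly" where
  "cyclotomic n = (if n = 0 then 1
     else (monom 1 n - 1) div (\<Prod>d\<in>{d. d dvd n \<and> d < n}. cyclotomic d))"
  by auto
termination
  by (relation "measure id") auto

type_synonym ratfun = "rat poly fract"

definition qvar :: ratfun where
  "qvar = Fract [:0, 1:] 1"

definition qint :: "int \<Rightarrow> ratfun" where
  "qint m = (1 - qvar powi m) / (1 - qvar)"

definition qpoch :: "ratfun \<Rightarrow> ratfun \<Rightarrow> nat \<Rightarrow> ratfun" where
  "qpoch x a k = (\<Prod>j<k. (1 - x * a ^ j))"

definition qcong :: "ratfun \<Rightarrow> ratfun \<Rightarrow> rat poly \<Rightarrow> bool" where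
  "qcong A B P \<longleftrightarrow> (\<exists>N D. D \<noteq> 0 \<and> coprime D P \<and> P dvd N \<and> A - B = Fract N D)"

definition qint_poly :: "nat \<Rightarrow> rat poly" where
  "qint_poly n = (\<Sum>i<n. monom 1 i)"

end

theory Submission
  imports Defs "HOL-Computational_Algebra.Field_as_Ring"
begin

text \<open>
  Write \<open>M = (n - t)/d\<close>, so that \<open>q^t\<close> agrees with \<open>q^(-dM)\<close> modulo \<open>\<Phi>_n(q)\<close>. Replace two of the four
  factors \<open>(q^t;q^d)_k\<close> by \<open>(x q^t;q^d)_k (q^t/x;q^d)_k\<close>, and likewise in the denominator. At \<open>x = q^n\<close>
  the sum terminates and is an instance of the well-poised 6-phi-5 summation, whose value is exactly
  the claimed right-hand side. The perturbed summands depend on \<open>x\<close> only through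
  \<open>\<delta> = x + 1/x - 2\<close>, which at \<open>x = q^n\<close> equals \<open>(1 - q^n)^2 / q^n\<close>. Hence modulo \<open>\<Phi>_n(q)^4\<close> the two
  sums differ by \<open>\<delta>\<close> times the derivative in \<open>\<delta>\<close> at \<open>0\<close>. Modulo \<open>\<Phi>_n(q)\<close> this derivative
  vanishes, since under \<open>k \<mapsto> M - k\<close> the summands are antisymmetric and their logarithmic derivatives
  symmetric. This gives the congruence modulo \<open>\<Phi>_n(q)^3\<close>. For the other divisors \<open>m\<close> of \<open>n\<close> both
  sides vanish modulo \<open>\<Phi>_m(q)\<close>, by the same antisymmetry within each block of \<open>m\<close> consecutive
  indices. Congruences modulo \<open>\<Phi>_m(q)^j\<close> are treated as membership in the \<open>j\<close>-th power of the ideal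
  generated by \<open>\<Phi>_m(q)\<close> in the ring of fractions whose denominator is coprime to \<open>\<Phi>_m(q)\<close>.
\<close>

subsection \<open>Cyclotomic polynomials\<close>

lemma monom_1_diff_dvd:
  assumes "a dvd b"
  shows "(monom 1 a - 1 :: 'a::comm_ring_1 poly) dvd monom 1 b - 1"
proof -
  obtain c where c: "b = a * c" using assms by auto
  have "monom 1 b = (monom 1 a :: 'a poly) ^ c"
    by (simp add: c monom_power mult.commute)
  then show ?thesis by (simp add: power_diff_1_eq)
qed

text \<open>The Euclidean algorithm runs on the exponents: subtracting a multiple of x^(n (m div n))
  - 1 turns x^m - 1 into x^(m mod n) - 1.\<close>

lemma monom_1_diff_dvd_gcd:
  fixes p :: "'a::comm_ring_1 poly"
  assumes "p dvd monom 1 a - 1" "p dvd monom 1 b - 1"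
  shows "p dvd monom 1 (gcd a b) - 1"
  using assms
proof (induction a b rule: gcd_nat_induct)
  case (base m)
  then show ?case by simp
next
  case (step m n)
  have "p dvd monom 1 (n * (m div n)) - 1"
    using step.prems(2) monom_1_diff_dvd[of n "n * (m div n)"] by (auto intro: dvd_trans)
  then have "p dvd (monom 1 m - 1) - monom 1 (m mod n) * (monom 1 (n * (m div n)) - 1)"
    using step.prems(1) by (auto intro: dvd_diff dvd_mult)
  moreover have "(monom 1 m - 1) - monom 1 (m mod n) * (monom 1 (n * (m div n)) - 1)
      = (monom 1 (m mod n) - 1 :: 'a poly)"
    by (simp add: algebra_simps mult_monom)
  ultimately have "p dvd monom 1 (m mod n) - 1" by simp
  then show ?case
    using step.IH step.prems(2) by (simp add: gcd_red_nat[of m n])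
qed

text \<open>A repeated factor divides the derivative n x^(n-1), hence also n x^n - n (x^n - 1) = n,
  which is a unit in characteristic 0.\<close>

lemma monom_1_diff_squarefree:
  fixes p :: "'a::field_char_0 poly"
  assumes n: "n > 0" and p: "p * p dvd monom 1 n - 1"
  shows "p dvd 1"
proof -
  obtain g where g: "monom 1 n - 1 = p * p * g" using p by (elim dvdE)
  have "pderiv (monom 1 n - 1 :: 'a poly) = p * (2 * pderiv p * g + p * pderiv g)"
    by (simp add: g pderiv_mult algebra_simps)
  then have "p dvd monom (of_nat n) (n - 1)"
    by (simp add: pderiv_diff pderiv_monom)
  then have "p dvd monom 1 1 * monom (of_nat n) (n - 1)" by (rule dvd_mult)
  then have 1: "p dvd monom (of_nat n) n" using n by (simp add: mult_monom)
  have "p dvd monom 1 n - 1" using p by (rule dvd_mult_left)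
  then have "p dvd [:of_nat n:] * (monom 1 n - 1)" by (rule dvd_mult)
  then have "p dvd monom (of_nat n) n - [:of_nat n:]"
    by (simp add: algebra_simps smult_monom)
  with 1 have "p dvd monom (of_nat n) n - (monom (of_nat n) n - [:of_nat n:])"
    by (rule dvd_diff)
  then have "p dvd [:of_nat n:]" by simp
  moreover have "[:of_nat n :: 'a:] dvd 1" using n by (simp add: is_unit_const_poly_iff dvd_field_iff)
  ultimately show ?thesis by (rule dvd_trans)
qed

declare cyclotomic.simps [simp del]

text \<open>A common divisor p also divides x^g - 1 with g = gcd(m,e), a proper divisor of m, so it
  occurs in the product of the other factors of x^m - 1. Then p^2 divides x^m - 1, which is
  squarefree. The product formula is a hypothesis up to m so that the lemma can serve inside the
  induction that proves this formula.\<close>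

lemma coprime_cyclotomic_aux:
  assumes formula: "\<And>k. 0 < k \<Longrightarrow> k \<le> m \<Longrightarrow> (\<Prod>e | e dvd k. cyclotomic e) = monom 1 k - 1"
    and m: "m > 0" and e: "\<not> m dvd e"
  shows "coprime (cyclotomic m) (monom 1 e - 1)"
proof (rule coprimeI)
  fix p assume p1: "p dvd cyclotomic m" and p2: "p dvd monom 1 e - 1"
  define g where "g = gcd m e"
  have "g \<noteq> m" using e gcd_dvd2[of m e] unfolding g_def by metis
  moreover have "g dvd m" "0 < g" using m unfolding g_def by auto
  ultimately have g: "g dvd m" "0 < g" "g < m" using m dvd_imp_le[of g m] by auto
  have fin: "finite {e. e dvd m}" using m by simp
  have split: "{e. e dvd m} = insert m {e. e dvd m \<and> e < m}"
    using m by (auto dest: dvd_imp_le)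
  have prod: "cyclotomic m * (\<Prod>e | e dvd m \<and> e < m. cyclotomic e) = monom 1 m - 1"
    using formula[OF m order_refl] fin by (subst (asm) split) simp
  have "p dvd monom 1 m - 1" unfolding prod[symmetric] using p1 by simp
  with p2 have "p dvd monom 1 g - 1" unfolding g_def by (blast intro: monom_1_diff_dvd_gcd)
  also have "monom 1 g - 1 = (\<Prod>e | e dvd g. cyclotomic e)" using formula[of g] g by simp
  also have "\<dots> dvd (\<Prod>e | e dvd m \<and> e < m. cyclotomic e)"
  proof (intro prod_dvd_prod_subset subsetI)
    show "finite {e. e dvd m \<and> e < m}" using fin by (rule finite_subset[rotated]) auto
    show "e \<in> {e. e dvd m \<and> e < m}" if "e \<in> {e. e dvd g}" for e
      using that g dvd_imp_le[of e g] by (auto intro: dvd_trans[of e g m])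
  qed
  finally have "p * p dvd monom 1 m - 1"
    unfolding prod[symmetric] using p1 by (rule mult_dvd_mono[rotated])
  then show "p dvd 1" using m by (rule monom_1_diff_squarefree[rotated])
qed

lemma prod_dvd_of_coprime:
  fixes f :: "'b \<Rightarrow> 'a::semiring_gcd"
  assumes "finite A" "\<And>i. i \<in> A \<Longrightarrow> f i dvd x"
    and "\<And>i j. i \<in> A \<Longrightarrow> j \<in> A \<Longrightarrow> i \<noteq> j \<Longrightarrow> coprime (f i) (f j)"
  shows "prod f A dvd x"
  using assms
proof (induction A rule: finite_induct)
  case (insert i A)
  have "coprime (f i) (prod f A)"
    using insert by (intro prod_coprime_right) auto
  then show ?case using insert by (auto intro: divides_mult)
qed auto

text \<open>The content is that the \<open>div\<close> in the recursive definition is exact. The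
  factors of the proper divisors of n each divide x^n - 1 and are pairwise coprime, so their product
  divides it too.\<close>

lemma prod_cyclotomic:
  "n > 0 \<Longrightarrow> (\<Prod>e | e dvd n. cyclotomic e) = monom 1 n - 1"
proof (induction n rule: less_induct)
  case (less n)
  let ?A = "{e. e dvd n \<and> e < n}"
  have fin: "finite ?A" using less.prems by (auto intro: finite_subset[of _ "{..<n}"])
  have pos: "0 < e" if "e \<in> ?A" for e using that less.prems by (auto intro!: Nat.gr0I)
  have dvd: "cyclotomic e dvd monom 1 e - 1" if "e \<in> ?A" for e
  proof -
    have "cyclotomic e dvd (\<Prod>d | d dvd e. cyclotomic d)"
      using pos[OF that] by (intro dvd_prodI) auto
    then show ?thesis using less.IH[of e] pos[OF that] that by simp
  qed
  \<comment> \<open>Of two distinct positive integers at least one fails to divide the other, so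
    this one-sided form suffices by symmetry.\<close>
  have cop: "coprime (cyclotomic a) (cyclotomic b)" if "a \<in> ?A" "b \<in> ?A" "\<not> a dvd b" for a b
  proof (rule coprime_divisors[OF dvd_refl dvd[OF that(2)]])
    show "coprime (cyclotomic a) (monom 1 b - 1)"
      using that pos[OF that(1)] less.IH by (intro coprime_cyclotomic_aux) auto
  qed
  have "(\<Prod>e\<in>?A. cyclotomic e) dvd monom 1 n - 1"
  proof (rule prod_dvd_of_coprime[OF fin])
    show "cyclotomic e dvd monom 1 n - 1" if "e \<in> ?A" for e
      using dvd[OF that] monom_1_diff_dvd[of e n] that by (auto intro: dvd_trans)
    show "coprime (cyclotomic a) (cyclotomic b)" if "a \<in> ?A" "b \<in> ?A" "a \<noteq> b" for a b
      using cop[OF that(1,2)] cop[OF that(2,1)] that(3) dvd_antisym[of a b]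
      by (cases "a dvd b") (auto simp: coprime_commute)
  qed
  then have "cyclotomic n * (\<Prod>e\<in>?A. cyclotomic e) = monom 1 n - 1"
    using less.prems by (subst cyclotomic.simps) simp
  moreover have "{e. e dvd n} = insert n ?A"
    using less.prems by (auto dest: dvd_imp_le)
  ultimately show ?case using fin by simp
qed

lemma coprime_cyclotomic:
  assumes "m > 0" "\<not> m dvd e"
  shows "coprime (cyclotomic m) (monom 1 e - 1)"
  using assms prod_cyclotomic by (intro coprime_cyclotomic_aux) auto

lemma cyclotomic_dvd:
  assumes "m > 0" "m dvd e"
  shows "cyclotomic m dvd monom 1 e - 1"
proof -
  have "cyclotomic m dvd (\<Prod>d | d dvd m. cyclotomic d)"
    using assms by (intro dvd_prodI) auto
  then show ?thesis
    using assms prod_cyclotomic[of m] monom_1_diff_dvd[of m e] by (auto intro: dvd_trans)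
qed

lemma coprime_cyclotomic_cyclotomic:
  assumes "a > 0" "b > 0" "a \<noteq> b"
  shows "coprime (cyclotomic a) (cyclotomic b)"
proof -
  have "coprime (cyclotomic a) (cyclotomic b)" if "a > 0" "b > 0" "\<not> a dvd b" for a b
    using coprime_cyclotomic[OF that(1,3)] cyclotomic_dvd[OF that(2) dvd_refl]
    by (rule coprime_divisors[OF dvd_refl, rotated])
  from this[OF assms(1,2)] this[OF assms(2,1)] show ?thesis
    using assms(3) dvd_antisym[of a b] by (cases "a dvd b") (auto simp: coprime_commute)
qed

lemma qint_poly_eq_prod:
  assumes "n > 0"
  shows "qint_poly n = (\<Prod>e | e dvd n \<and> e \<noteq> 1. cyclotomic e)"
proof -
  have X: "monom 1 1 - 1 \<noteq> (0 :: rat poly)"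
    by (simp add: monom_altdef one_pCons)
  have "cyclotomic 1 = monom 1 1 - 1" using prod_cyclotomic[of 1] by simp
  moreover have "{e. e dvd n} = insert 1 {e. e dvd n \<and> e \<noteq> 1}" by auto
  moreover have "finite {e. e dvd n \<and> e \<noteq> 1}" using assms by simp
  ultimately have "(monom 1 1 - 1) * (\<Prod>e | e dvd n \<and> e \<noteq> 1. cyclotomic e) = monom 1 n - 1"
    using prod_cyclotomic[OF assms] by simp
  moreover have "(monom 1 1 - 1) * qint_poly n = monom 1 n - 1"
    using power_diff_1_eq[of "monom 1 1 :: rat poly" n]
    by (simp add: qint_poly_def monom_power)
  ultimately have "(monom 1 1 - 1) * qint_poly n
      = (monom 1 1 - 1) * (\<Prod>e | e dvd n \<and> e \<noteq> 1. cyclotomic e)" by simp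
  then show ?thesis by (rule mult_left_cancel[OF X, THEN iffD1])
qed

subsection \<open>Powers of the maximal ideal in a localization\<close>

text \<open>For j = 0 this is the local ring itself. The shape of the fraction is that of
  \<open>qcong\<close>, so \<open>qcong A B P\<close> says that A - B lies in
  \<open>loc_ideal P 1\<close>.\<close>

definition loc_ideal :: "'a::{ring_gcd, idom_divide} \<Rightarrow> nat \<Rightarrow> 'a fract set" where
  "loc_ideal P j = {x. \<exists>N D. D \<noteq> 0 \<and> coprime D P \<and> P ^ j dvd N \<and> x = Fract N D}"

definition loc_unit :: "'a::{ring_gcd, idom_divide} \<Rightarrow> 'a fract set" where
  "loc_unit P = {x. x \<noteq> 0 \<and> x \<in> loc_ideal P 0 \<and> inverse x \<in> loc_ideal P 0}"

lemma loc_idealI: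
  "D \<noteq> 0 \<Longrightarrow> coprime D P \<Longrightarrow> P ^ j dvd N \<Longrightarrow> Fract N D \<in> loc_ideal P j"
  unfolding loc_ideal_def by blast

lemma loc_idealE:
  assumes "x \<in> loc_ideal P j"
  obtains N D where "D \<noteq> 0" "coprime D P" "P ^ j dvd N" "x = Fract N D"
  using assms unfolding loc_ideal_def by blast

lemma loc_ideal_add: "x \<in> loc_ideal P j \<Longrightarrow> y \<in> loc_ideal P j \<Longrightarrow> x + y \<in> loc_ideal P j"
  by (elim loc_idealE) (auto intro!: loc_idealI dvd_add dvd_mult2)

lemma loc_ideal_uminus: "x \<in> loc_ideal P j \<Longrightarrow> - x \<in> loc_ideal P j"
  by (elim loc_idealE) (auto intro!: loc_idealI)

lemma loc_ideal_diff: "x \<in> loc_ideal P j \<Longrightarrow> y \<in> loc_ideal P j \<Longrightarrow> x - y \<in> loc_ideal P j"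
  using loc_ideal_add[of x P j "- y"] loc_ideal_uminus[of y P j] by simp

lemma loc_ideal_mult:
  "x \<in> loc_ideal P j \<Longrightarrow> y \<in> loc_ideal P k \<Longrightarrow> x * y \<in> loc_ideal P (j + k)"
  by (elim loc_idealE) (auto intro!: loc_idealI mult_dvd_mono simp: power_add)

lemma loc_ideal_mult_left: "x \<in> loc_ideal P 0 \<Longrightarrow> y \<in> loc_ideal P j \<Longrightarrow> x * y \<in> loc_ideal P j"
  using loc_ideal_mult[of x P 0 y j] by simp

lemma loc_ideal_mult_right: "x \<in> loc_ideal P j \<Longrightarrow> y \<in> loc_ideal P 0 \<Longrightarrow> x * y \<in> loc_ideal P j"
  using loc_ideal_mult[of x P j y 0] by simp

lemma loc_ideal_mono: "x \<in> loc_ideal P k \<Longrightarrow> j \<le> k \<Longrightarrow> x \<in> loc_ideal P j"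
  by (elim loc_idealE) (auto intro!: loc_idealI intro: power_le_dvd)

lemma to_fract_in_loc_ideal: "P ^ j dvd x \<Longrightarrow> to_fract x \<in> loc_ideal P j"
  by (auto simp: to_fract_def intro!: loc_idealI)

lemma loc_ideal_0: "0 \<in> loc_ideal P j"
  using to_fract_in_loc_ideal[of P j 0] by simp

lemma loc_ideal_1: "1 \<in> loc_ideal P 0"
  using to_fract_in_loc_ideal[of P 0 1] by simp

lemma loc_ideal_sum: "(\<And>i. i \<in> A \<Longrightarrow> f i \<in> loc_ideal P j) \<Longrightarrow> sum f A \<in> loc_ideal P j"
  by (induction A rule: infinite_finite_induct) (auto intro: loc_ideal_0 loc_ideal_add)

lemma loc_ideal_prod: "(\<And>i. i \<in> A \<Longrightarrow> f i \<in> loc_ideal P 0) \<Longrightarrow> prod f A \<in> loc_ideal P 0"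
  by (induction A rule: infinite_finite_induct) (auto intro: loc_ideal_1 loc_ideal_mult_left)

lemma loc_ideal_power: "x \<in> loc_ideal P j \<Longrightarrow> x ^ k \<in> loc_ideal P (k * j)"
  by (induction k) (auto intro: loc_ideal_1 loc_ideal_mult)

lemma loc_ideal_power_0: "x \<in> loc_ideal P 0 \<Longrightarrow> x ^ k \<in> loc_ideal P 0"
  using loc_ideal_power[of x P 0 k] by simp

lemma loc_unit_ideal: "x \<in> loc_unit P \<Longrightarrow> x \<in> loc_ideal P 0"
  by (simp add: loc_unit_def)

lemma loc_unit_nonzero: "x \<in> loc_unit P \<Longrightarrow> x \<noteq> 0"
  by (simp add: loc_unit_def)

lemma loc_unit_inverse: "x \<in> loc_unit P \<Longrightarrow> inverse x \<in> loc_unit P"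
  by (simp add: loc_unit_def)

lemma loc_unit_mult: "x \<in> loc_unit P \<Longrightarrow> y \<in> loc_unit P \<Longrightarrow> x * y \<in> loc_unit P"
  by (auto simp: loc_unit_def inverse_mult_distrib intro: loc_ideal_mult_left)

lemma loc_unit_divide: "x \<in> loc_unit P \<Longrightarrow> y \<in> loc_unit P \<Longrightarrow> x / y \<in> loc_unit P"
  by (simp add: divide_inverse loc_unit_mult loc_unit_inverse)

lemma loc_unit_uminus: "x \<in> loc_unit P \<Longrightarrow> - x \<in> loc_unit P"
  by (auto simp: loc_unit_def intro: loc_ideal_uminus)

lemma loc_unit_1: "1 \<in> loc_unit P"
  by (auto simp: loc_unit_def intro: loc_ideal_1)

lemma loc_unit_power: "x \<in> loc_unit P \<Longrightarrow> x ^ k \<in> loc_unit P"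
  by (induction k) (auto intro: loc_unit_1 loc_unit_mult)

lemma loc_unit_prod: "(\<And>i. i \<in> A \<Longrightarrow> f i \<in> loc_unit P) \<Longrightarrow> prod f A \<in> loc_unit P"
  by (induction A rule: infinite_finite_induct) (auto intro: loc_unit_1 loc_unit_mult)

lemma loc_ideal_divide_unit:
  "x \<in> loc_ideal P j \<Longrightarrow> y \<in> loc_unit P \<Longrightarrow> x / y \<in> loc_ideal P j"
  by (simp add: divide_inverse loc_ideal_mult_right loc_unit_ideal loc_unit_inverse)

lemma to_fract_loc_unit:
  assumes "x \<noteq> 0" "coprime x P"
  shows "to_fract x \<in> loc_unit P"
proof -
  have "inverse (to_fract x) = Fract 1 x" using assms by (simp add: to_fract_def)
  then show ?thesis
    using assms by (auto simp: loc_unit_def intro!: to_fract_in_loc_ideal loc_idealI)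
qed

section \<open>Arithmetic of congruences in the local ring\<close>

lemma loc_ideal_mult_cong:
  assumes "x - x' \<in> loc_ideal P j" "y - y' \<in> loc_ideal P j"
    and "x \<in> loc_ideal P 0" "y' \<in> loc_ideal P 0"
  shows "x * y - x' * y' \<in> loc_ideal P j"
proof -
  have "x * y - x' * y' = x * (y - y') + (x - x') * y'" by (simp add: algebra_simps)
  then show ?thesis
    using loc_ideal_add[OF loc_ideal_mult_left[OF assms(3,2)] loc_ideal_mult_right[OF assms(1,4)]]
    by simp
qed

lemma loc_ideal_inverse_cong:
  assumes "x - y \<in> loc_ideal P j" "x \<in> loc_unit P" "y \<in> loc_unit P"
  shows "inverse x - inverse y \<in> loc_ideal P j"
proof -
  have "inverse x - inverse y = - ((x - y) / (x * y))"
    using assms(2,3)[THEN loc_unit_nonzero] by (simp add: field_simps)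
  then show ?thesis
    using assms by (auto intro!: loc_ideal_uminus loc_ideal_divide_unit loc_unit_mult)
qed

lemma loc_ideal_divide_cong:
  assumes "x - x' \<in> loc_ideal P j" "y - y' \<in> loc_ideal P j"
    and "x \<in> loc_ideal P 0" "y \<in> loc_unit P" "y' \<in> loc_unit P"
  shows "x / y - x' / y' \<in> loc_ideal P j"
  unfolding divide_inverse
  using assms by (intro loc_ideal_mult_cong loc_ideal_inverse_cong)
    (auto intro: loc_unit_ideal loc_unit_inverse)

lemma loc_ideal_prod_cong:
  assumes "\<And>i. i \<in> A \<Longrightarrow> f i - g i \<in> loc_ideal P j"
    and "\<And>i. i \<in> A \<Longrightarrow> f i \<in> loc_ideal P 0" "\<And>i. i \<in> A \<Longrightarrow> g i \<in> loc_ideal P 0"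
  shows "prod f A - prod g A \<in> loc_ideal P j"
  using assms
proof (induction A rule: infinite_finite_induct)
  case (insert i A)
  then show ?case
    by (auto intro!: loc_ideal_mult_cong loc_ideal_prod)
qed (auto intro: loc_ideal_0)

lemma loc_ideal_power_cong:
  assumes "x - y \<in> loc_ideal P j" "x \<in> loc_ideal P 0" "y \<in> loc_ideal P 0"
  shows "x ^ k - y ^ k \<in> loc_ideal P j"
  using loc_ideal_prod_cong[of "{..<k}" "\<lambda>_. x" "\<lambda>_. y" P j] assms by simp

text \<open>A single fraction has to serve for all \<open>P i\<close>. The one in lowest terms does:
  its denominator divides every other denominator of x, so coprimality to \<open>P i\<close> and
  divisibility of the numerator carry over from each local representation.\<close>

lemma loc_ideal_prod_coprime:
  fixes P :: "'b \<Rightarrow> rat poly"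
  assumes "finite A" and "\<And>i. i \<in> A \<Longrightarrow> x \<in> loc_ideal (P i) (e i)"
    and "\<And>i j. i \<in> A \<Longrightarrow> j \<in> A \<Longrightarrow> i \<noteq> j \<Longrightarrow> coprime (P i) (P j)"
  obtains N D where "D \<noteq> 0" "coprime D (\<Prod>i\<in>A. P i ^ e i)" "(\<Prod>i\<in>A. P i ^ e i) dvd N"
    "x = Fract N D"
proof -
  define N D where "N = fst (quot_of_fract x)" and "D = snd (quot_of_fract x)"
  have D: "D \<noteq> 0" and ND: "coprime N D" and x: "x = Fract N D"
    by (simp_all add: N_def D_def coprime_quot_of_fract)
  have *: "coprime D (P i) \<and> P i ^ e i dvd N" if i: "i \<in> A" for i
  proof -
    obtain N' D' where N': "D' \<noteq> 0" "coprime D' (P i)" "P i ^ e i dvd N'" "x = Fract N' D'"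
      using assms(2)[OF i] by (elim loc_idealE)
    have eq: "N * D' = N' * D" using N'(1,4) x D by (simp add: eq_fract)
    have "D dvd N * D'" unfolding eq by simp
    then have "D dvd D'" using ND by (simp add: coprime_dvd_mult_right_iff coprime_commute)
    then have 1: "coprime D (P i)" using N'(2) by (rule coprime_divisors[OF _ dvd_refl])
    have "P i ^ e i dvd N * D'" unfolding eq using N'(3) by simp
    then have 2: "P i ^ e i dvd N"
      using N'(2) by (subst (asm) coprime_dvd_mult_left_iff) (auto simp: coprime_commute)
    show ?thesis using 1 2 by blast
  qed
  have "coprime D (\<Prod>i\<in>A. P i ^ e i)"
    using * by (intro prod_coprime_right) (simp add: coprime_commute)
  moreover have "(\<Prod>i\<in>A. P i ^ e i) dvd N"
    using assms(1,3) * by (intro prod_dvd_of_coprime) auto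
  ultimately show ?thesis using that D x by blast
qed

subsection \<open>Local properties of powers of the indeterminate\<close>

lemma qvar_eq: "qvar = to_fract (monom 1 1)"
  by (simp add: qvar_def to_fract_def monom_altdef)

lemma to_fract_power: "to_fract (x ^ k) = to_fract x ^ k"
  by (induction k) simp_all

lemma qvar_power: "qvar ^ k = to_fract (monom 1 k)"
  by (simp add: qvar_eq to_fract_power[symmetric] monom_power)

lemma qvar_nonzero [simp]: "qvar \<noteq> 0"
  by (simp add: qvar_eq)

lemma one_minus_qvar_power: "1 - qvar ^ k = - to_fract (monom 1 k - 1)"
  by (simp add: qvar_power)

text \<open>Reduces negative exponents to positive ones, since the extra factor is a unit in each of
  the local rings considered.\<close>

lemma one_minus_qvar_powi_uminus:
  "1 - qvar powi (- e) = - (qvar powi (- e)) * (1 - qvar powi e)"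
proof -
  have "qvar powi (- e) * qvar powi e = 1" by (simp add: power_int_minus)
  then show ?thesis by (simp add: right_diff_distrib)
qed

lemma qvar_power_eq_1_iff: "qvar ^ k = 1 \<longleftrightarrow> k = 0"
proof -
  have "qvar ^ k = 1 \<longleftrightarrow> monom 1 k = (monom 1 0 :: rat poly)"
    by (simp add: qvar_power flip: to_fract_1)
  then show ?thesis using monom_eq_iff'[of "1 :: rat" k 1 0] by simp
qed

lemma qvar_powi_eq_1_iff [simp]: "qvar powi e = 1 \<longleftrightarrow> e = 0"
  by (auto simp: power_int_def qvar_power_eq_1_iff power_inverse)

context
  fixes m :: nat
  assumes m: "m > 1"
begin

private abbreviation (input) \<open>I \<equiv> loc_ideal (cyclotomic m)\<close>
private abbreviation (input) \<open>U \<equiv> loc_unit (cyclotomic m)\<close>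

lemma qvar_powi_unit: "qvar powi e \<in> U"
proof -
  have "coprime (monom 1 1) (cyclotomic m)"
  proof (rule coprimeI)
    fix p :: "rat poly" assume p: "p dvd monom 1 1" "p dvd cyclotomic m"
    have "p dvd monom 1 1 * monom 1 (m - 1)" using p(1) by (rule dvd_mult2)
    then have "p dvd monom 1 m" using m by (simp add: mult_monom)
    moreover have "p dvd monom 1 m - 1"
      using p(2) cyclotomic_dvd[of m m] m by (auto intro: dvd_trans)
    ultimately have "p dvd monom 1 m - (monom 1 m - 1)" by (rule dvd_diff)
    then show "p dvd 1" by simp
  qed
  then have q: "qvar \<in> U" unfolding qvar_eq by (intro to_fract_loc_unit) auto
  then show ?thesis
    by (auto simp: power_int_def intro: loc_unit_power loc_unit_inverse)
qed

lemma one_minus_qvar_powi_unit: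
  assumes "\<not> int m dvd e"
  shows "1 - qvar powi e \<in> U"
proof -
  have *: "1 - qvar powi int k \<in> U" if "\<not> m dvd k" for k
  proof -
    have "coprime (monom 1 k - 1) (cyclotomic m)"
      using coprime_cyclotomic[OF _ that] m by (simp add: coprime_commute)
    moreover have "monom 1 k - 1 \<noteq> (0 :: rat poly)"
      using qvar_power_eq_1_iff[of k] that by (auto simp: qvar_power)
    ultimately show ?thesis
      by (simp only: power_int_of_nat one_minus_qvar_power)
        (intro loc_unit_uminus to_fract_loc_unit)
  qed
  show ?thesis
  proof (cases e)
    case (nonneg k)
    then show ?thesis using * assms by simp
  next
    case (neg k)
    then have "\<not> m dvd Suc k" using assms by (metis dvd_minus_iff int_dvd_int_iff)
    from *[OF this] show ?thesis
      unfolding neg one_minus_qvar_powi_uminus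
      by (intro loc_unit_mult loc_unit_uminus qvar_powi_unit)
  qed
qed

lemma one_minus_qvar_powi_ideal:
  assumes "int m dvd e"
  shows "1 - qvar powi e \<in> I 1"
proof -
  have *: "1 - qvar powi int k \<in> I 1" if "m dvd k" for k
    using cyclotomic_dvd[OF _ that] m
    by (simp only: power_int_of_nat one_minus_qvar_power)
      (intro loc_ideal_uminus to_fract_in_loc_ideal, auto)
  show ?thesis
  proof (cases e)
    case (nonneg k)
    then show ?thesis using * assms by simp
  next
    case (neg k)
    then have "m dvd Suc k" using assms by (metis dvd_minus_iff int_dvd_int_iff)
    from *[OF this] show ?thesis
      unfolding neg one_minus_qvar_powi_uminus
      by (intro loc_ideal_mult_left loc_ideal_uminus loc_unit_ideal[OF qvar_powi_unit])
  qed
qed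

lemma qvar_powi_cong:
  assumes "int m dvd e - f"
  shows "qvar powi e - qvar powi f \<in> I 1"
proof -
  have "qvar powi e - qvar powi f = - (qvar powi f * (1 - qvar powi (e - f)))"
    by (simp add: power_int_diff right_diff_distrib)
  then show ?thesis
    using one_minus_qvar_powi_ideal[OF assms] loc_unit_ideal[OF qvar_powi_unit[of f]]
    by (auto intro: loc_ideal_uminus loc_ideal_mult_left)
qed

lemma one_minus_qvar_powi_integral: "1 - qvar powi e \<in> I 0"
  by (intro loc_ideal_diff loc_ideal_1 loc_unit_ideal qvar_powi_unit)

text \<open>For k = m c with c > 0 the quotient is 1 + q^m + ... + q^(m(c-1)), which is congruent to
  the rational unit c modulo \<open>cyclotomic m\<close>. Thus all nonzero 1 - q^e with m dividing e
  are unit multiples of 1 - q^m.\<close>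

lemma qvar_quotient_unit:
  assumes "int m dvd e" "e \<noteq> 0"
  shows "(1 - qvar powi e) / (1 - qvar ^ m) \<in> U"
proof -
  have *: "(1 - qvar powi int k) / (1 - qvar ^ m) \<in> U" if "m dvd k" "k \<noteq> 0" for k
  proof -
    obtain c where c: "k = m * c" using \<open>m dvd k\<close> by auto
    with that have "c > 0" by auto
    define s :: "rat poly" where "s = (\<Sum>i<c. monom 1 (m * i))"
    have "coprime s (cyclotomic m)"
    proof (rule coprimeI)
      fix p assume p: "p dvd s" "p dvd cyclotomic m"
      have "p dvd s - (\<Sum>i<c. monom 1 (m * i) - 1)"
        using p(1) m by (intro dvd_diff dvd_sum dvd_trans[OF p(2) cyclotomic_dvd]) auto
      then have "p dvd of_nat c" by (simp add: s_def sum_subtractf)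
      moreover have "of_nat c dvd (1 :: rat poly)"
        using \<open>c > 0\<close> by (simp add: of_nat_poly is_unit_const_poly_iff dvd_field_iff)
      ultimately show "p dvd 1" by (rule dvd_trans)
    qed
    moreover have s: "(qvar ^ m - 1) * to_fract s = qvar ^ k - 1"
    proof -
      have "to_fract s = (\<Sum>i<c. (qvar ^ m) ^ i)"
        by (simp add: s_def qvar_power[symmetric] power_mult)
      then show ?thesis by (simp add: c power_mult power_diff_1_eq[of "qvar ^ m"])
    qed
    moreover have "s \<noteq> 0"
      using s that qvar_power_eq_1_iff[of k] by auto
    ultimately have "to_fract s \<in> U" by (intro to_fract_loc_unit)
    moreover have "(1 - qvar powi int k) / (1 - qvar ^ m) = to_fract s"
    proof -
      have "qvar ^ m \<noteq> 1" using m by (simp add: qvar_power_eq_1_iff)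
      then show ?thesis using s by (simp add: field_simps)
    qed
    ultimately show ?thesis by simp
  qed
  show ?thesis
  proof (cases e)
    case (nonneg k)
    then show ?thesis using * assms by simp
  next
    case (neg k)
    then have "m dvd Suc k" using assms by (metis dvd_minus_iff int_dvd_int_iff)
    from *[OF this] show ?thesis
      unfolding neg one_minus_qvar_powi_uminus times_divide_eq_right[symmetric]
      by (intro loc_unit_mult loc_unit_uminus qvar_powi_unit) auto
  qed
qed

lemma qvar_quotient_integral:
  assumes "int m dvd e"
  shows "(1 - qvar powi e) / (1 - qvar ^ m) \<in> I 0"
  using qvar_quotient_unit[OF assms] by (cases "e = 0") (auto intro: loc_ideal_0 loc_unit_ideal)

end

subsection \<open>A terminating well-poised sum\<close>

text \<open>The increment of the telescoping relation below, with p = Q^(M+1), y = Q^(N+1) and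
  \<open>W\<close> the factor shared by both weights.\<close>

lemma well_poised_step:
  fixes a b p y W :: "'a::field"
  assumes "b \<noteq> 0" "y \<noteq> 1" "a * y \<noteq> b" "a * p * y \<noteq> 1"
  shows "(1 - a * p / b) * (1 - p)
        * ((1 - a * y\<^sup>2) * (W * (p - 1) * y * (1 - a * p) / ((1 - y)\<^sup>2 * (1 - a * y / b) * (1 - a * p * y))))
      - (1 - a * p) * (1 - p / b) * ((1 - a * y\<^sup>2) * (W * (p - y) / ((1 - y)\<^sup>2 * (1 - a * y / b))))
    = (1 - a * y)\<^sup>2 * (1 - b * y) * (1 - a * p) * p / b
        * (W * (p - y) / ((1 - y)\<^sup>2 * (1 - a * y / b))) / (1 - a * p * y)
      - (1 - a * p) * p * W"
proof -
  \<comment> \<open>All four terms are \<open>u\<close> times a polynomial, which leaves the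
    polynomial identity 5.\<close>
  define u where "u = W * (1 - a * p) / ((1 - y)\<^sup>2 * (b - a * y) * (1 - a * p * y))"
  have nz: "1 - y \<noteq> 0" "b - a * y \<noteq> 0" "1 - a * p * y \<noteq> 0" using assms by auto
  have e: "1 - a * y / b = (b - a * y) / b" using assms by (simp add: field_simps)
  have 1: "(1 - a * p / b) * (1 - p)
        * ((1 - a * y\<^sup>2) * (W * (p - 1) * y * (1 - a * p) / ((1 - y)\<^sup>2 * (1 - a * y / b) * (1 - a * p * y))))
      = u * ((b - a * p) * (1 - p) * (1 - a * y\<^sup>2) * (p - 1) * y)"
    using assms(1) by (simp add: e u_def diff_divide_eq_iff mult_ac)
  have 2: "(1 - a * p) * (1 - p / b) * ((1 - a * y\<^sup>2) * (W * (p - y) / ((1 - y)\<^sup>2 * (1 - a * y / b))))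
      = u * ((b - p) * (1 - a * y\<^sup>2) * (p - y) * (1 - a * p * y))"
    using assms(1) nz by (simp add: e u_def diff_divide_eq_iff mult_ac)
  have 3: "(1 - a * y)\<^sup>2 * (1 - b * y) * (1 - a * p) * p / b
        * (W * (p - y) / ((1 - y)\<^sup>2 * (1 - a * y / b))) / (1 - a * p * y)
      = u * ((1 - a * y)\<^sup>2 * (1 - b * y) * p * (p - y))"
    using assms(1) by (simp add: e u_def mult_ac)
  have 4: "(1 - a * p) * p * W = u * (p * ((1 - y)\<^sup>2 * (b - a * y) * (1 - a * p * y)))"
    using nz by (simp add: u_def mult_ac)
  have 5: "(b - a * p) * (1 - p) * (1 - a * y\<^sup>2) * (p - 1) * y
       - (b - p) * (1 - a * y\<^sup>2) * (p - y) * (1 - a * p * y)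
     = (1 - a * y)\<^sup>2 * (1 - b * y) * p * (p - y) - p * ((1 - y)\<^sup>2 * (b - a * y) * (1 - a * p * y))"
    by algebra
  show ?thesis unfolding 1 2 3 4 right_diff_distrib[symmetric] 5 ..
qed

context
  fixes Q \<alpha> \<beta> :: "'a::field"
  assumes Q: "Q \<noteq> 0" "\<And>j. j > 0 \<Longrightarrow> Q ^ j \<noteq> 1"
    and \<alpha>: "\<And>j. j > 0 \<Longrightarrow> \<alpha> * Q ^ j \<noteq> 1"
    and \<beta>: "\<beta> \<noteq> 0" "\<And>j. j > 0 \<Longrightarrow> \<alpha> * Q ^ j \<noteq> \<beta>"
begin

private definition poch :: "'a \<Rightarrow> nat \<Rightarrow> 'a" where
  "poch x k = (\<Prod>j<k. 1 - x * Q ^ j)"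

text \<open>The terminating 6-phi-5 summand in base Q with leading parameter \<alpha> and further
  parameters \<alpha>, \<beta>, Q^(-M), apart from the very-well-poised factor. The product of Q^M -
  Q^j is (Q^(-M);Q)_k Q^(Mk), written without negative powers.\<close>

private definition weight :: "nat \<Rightarrow> nat \<Rightarrow> 'a" where
  "weight M k = poch \<alpha> k ^ 2 * poch \<beta> k / (poch Q k ^ 2 * poch (\<alpha> * Q / \<beta>) k)
     * (Q / \<beta>) ^ k * (\<Prod>j<k. Q ^ M - Q ^ j) / poch (\<alpha> * Q ^ (M + 1)) k"

private lemma poch_Suc: "poch x (Suc k) = poch x k * (1 - x * Q ^ k)"
  by (simp add: poch_def)

private lemma poch_Suc': "poch x (Suc k) = (1 - x) * poch (x * Q) k"
  by (simp add: poch_def prod.lessThan_Suc_shift mult_ac del: prod.lessThan_Suc)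

private lemma prod_diff_Suc:
  "(\<Prod>j<Suc k. Q ^ Suc M - Q ^ j) = (Q ^ Suc M - 1) * Q ^ k * (\<Prod>j<k. Q ^ M - Q ^ j)"
proof -
  have "(\<Prod>j<k. Q ^ Suc M - Q ^ Suc j) = (\<Prod>j<k. Q * (Q ^ M - Q ^ j))"
    by (simp add: algebra_simps)
  also have "\<dots> = Q ^ k * (\<Prod>j<k. Q ^ M - Q ^ j)"
    by (simp add: prod.distrib)
  finally show ?thesis by (simp only: prod.lessThan_Suc_shift) (simp add: mult_ac)
qed

text \<open>This and the next lemma express both neighbouring weights through
  \<open>weight M N\<close>, in the form that \<open>well_poised_step\<close> expects.\<close>

private lemma weight_Suc:
  fixes M N :: nat
  defines "p \<equiv> Q ^ Suc M" and "z \<equiv> Q ^ N"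
  shows "weight M (Suc N) = weight M N * (1 - \<alpha> * z)\<^sup>2 * (1 - \<beta> * z) / (\<beta> * (1 - \<alpha> * p * z))
     * (p - Q * z) / ((1 - Q * z)\<^sup>2 * (1 - \<alpha> * (Q * z) / \<beta>))"
proof -
  have "p - Q * z = Q * (Q ^ M - z)" by (simp add: p_def algebra_simps)
  moreover have "poch (\<alpha> * p) (Suc N) = poch (\<alpha> * p) N * (1 - \<alpha> * p * z)"
    by (simp add: poch_Suc z_def mult_ac)
  moreover have "poch Q (Suc N) = poch Q N * (1 - Q * z)"
    "poch (\<alpha> * Q / \<beta>) (Suc N) = poch (\<alpha> * Q / \<beta>) N * (1 - \<alpha> * (Q * z) / \<beta>)"
    by (simp_all add: poch_Suc z_def mult_ac)
  ultimately show ?thesis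
    by (simp add: weight_def poch_Suc[of \<alpha>] poch_Suc[of \<beta>] p_def z_def power_mult_distrib mult_ac)
qed

private lemma weight_Suc_Suc:
  fixes M N :: nat
  defines "p \<equiv> Q ^ Suc M" and "z \<equiv> Q ^ N"
  shows "weight (Suc M) (Suc N) = weight M N * (1 - \<alpha> * z)\<^sup>2 * (1 - \<beta> * z) / (\<beta> * (1 - \<alpha> * p * z))
     * (p - 1) * (Q * z) * (1 - \<alpha> * p) / ((1 - Q * z)\<^sup>2 * (1 - \<alpha> * (Q * z) / \<beta>) * (1 - \<alpha> * p * (Q * z)))"
proof -
  have nz: "1 - \<alpha> * p \<noteq> 0" using \<alpha>[of "Suc M"] by (simp add: p_def)
  have "(1 - \<alpha> * p) * poch (\<alpha> * p * Q) (Suc N) = poch (\<alpha> * p) (Suc (Suc N))"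
    by (rule poch_Suc'[symmetric])
  also have "\<dots> = poch (\<alpha> * p) N * (1 - \<alpha> * p * z) * (1 - \<alpha> * p * (Q * z))"
    by (simp add: poch_Suc z_def mult_ac)
  finally have e1: "poch (\<alpha> * p * Q) (Suc N)
      = poch (\<alpha> * p) N * (1 - \<alpha> * p * z) * (1 - \<alpha> * p * (Q * z)) / (1 - \<alpha> * p)"
    using nz by (simp add: field_simps)
  have e2: "\<alpha> * Q ^ (Suc M + 1) = \<alpha> * p * Q" "\<alpha> * Q ^ (M + 1) = \<alpha> * p"
    by (simp_all add: p_def mult_ac)
  have e3: "poch Q (Suc N) = poch Q N * (1 - Q * z)"
    "poch (\<alpha> * Q / \<beta>) (Suc N) = poch (\<alpha> * Q / \<beta>) N * (1 - \<alpha> * (Q * z) / \<beta>)"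
    by (simp_all add: poch_Suc z_def mult_ac)
  have e4: "poch \<alpha> (Suc N) = poch \<alpha> N * (1 - \<alpha> * z)" "poch \<beta> (Suc N) = poch \<beta> N * (1 - \<beta> * z)"
    by (simp_all add: poch_Suc z_def)
  have e5: "(\<Prod>j<Suc N. Q ^ Suc M - Q ^ j) = (p - 1) * z * (\<Prod>j<N. Q ^ M - Q ^ j)"
    by (simp only: prod_diff_Suc p_def z_def)
  show ?thesis
    unfolding weight_def e2 e1 e3 e4 e5 by (simp add: power_mult_distrib mult_ac)
qed

text \<open>A recurrence in M for the partial sums, with an explicit boundary term. Its two
  coefficients are dictated by the ratio of the closed forms at M + 1 and M.\<close>

private lemma weight_telescope:
  fixes M N :: nat
  defines "p \<equiv> Q ^ Suc M"
  shows "(1 - \<alpha> * p / \<beta>) * (1 - p) * (\<Sum>k\<le>N. (1 - \<alpha> * (Q ^ k)\<^sup>2) * weight (Suc M) k)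
       - (1 - \<alpha> * p) * (1 - p / \<beta>) * (\<Sum>k\<le>N. (1 - \<alpha> * (Q ^ k)\<^sup>2) * weight M k)
     = (1 - \<alpha> * p) * p
        * (weight M N * (1 - \<alpha> * Q ^ N)\<^sup>2 * (1 - \<beta> * Q ^ N) / (\<beta> * (1 - \<alpha> * p * Q ^ N)))"
proof (induction N)
  case 0
  have w: "weight L 0 = 1" for L by (simp add: weight_def poch_def)
  have nz: "1 - \<alpha> * p \<noteq> 0" using \<alpha>[of "Suc M"] by (simp add: p_def)
  have "(1 - \<alpha> * p / \<beta>) * (1 - p) - (1 - \<alpha> * p) * (1 - p / \<beta>) = (1 - \<alpha>) * p * (1 - \<beta>) / \<beta>"
    using \<beta>(1) by (simp add: field_simps)
  then have "(1 - \<alpha> * p / \<beta>) * (1 - p) * (1 - \<alpha>) - (1 - \<alpha> * p) * (1 - p / \<beta>) * (1 - \<alpha>)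
     = (1 - \<alpha>) * p * (1 - \<beta>) / \<beta> * (1 - \<alpha>)"
    by (simp only: left_diff_distrib[symmetric])
  then show ?case using nz by (simp add: w power2_eq_square)
next
  case (Suc N)
  define y where "y = Q ^ Suc N"
  define W where "W = weight M N * (1 - \<alpha> * Q ^ N)\<^sup>2 * (1 - \<beta> * Q ^ N) / (\<beta> * (1 - \<alpha> * p * Q ^ N))"
  have y: "y = Q * Q ^ N" by (simp add: y_def)
  have w1: "weight (Suc M) (Suc N)
      = W * (p - 1) * y * (1 - \<alpha> * p) / ((1 - y)\<^sup>2 * (1 - \<alpha> * y / \<beta>) * (1 - \<alpha> * p * y))"
    using weight_Suc_Suc[of M N, folded p_def y] unfolding W_def .
  have w2: "weight M (Suc N) = W * (p - y) / ((1 - y)\<^sup>2 * (1 - \<alpha> * y / \<beta>))"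
    using weight_Suc[of M N, folded p_def y] unfolding W_def .
  have "y \<noteq> 1" unfolding y_def by (rule Q(2)) simp
  moreover have "\<alpha> * y \<noteq> \<beta>" unfolding y_def by (rule \<beta>(2)) simp
  moreover have "\<alpha> * p * y \<noteq> 1"
    using \<alpha>[of "Suc M + Suc N"] by (simp only: p_def y_def power_add) (simp add: mult_ac)
  ultimately have step: "(1 - \<alpha> * p / \<beta>) * (1 - p) * ((1 - \<alpha> * y\<^sup>2) * weight (Suc M) (Suc N))
       - (1 - \<alpha> * p) * (1 - p / \<beta>) * ((1 - \<alpha> * y\<^sup>2) * weight M (Suc N))
     = (1 - \<alpha> * y)\<^sup>2 * (1 - \<beta> * y) * (1 - \<alpha> * p) * p / \<beta> * weight M (Suc N) / (1 - \<alpha> * p * y)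
       - (1 - \<alpha> * p) * p * W"
    unfolding w1 w2 using \<beta>(1) by (intro well_poised_step)
  have rearr: "c1 * (s1 + f1) - c2 * (s2 + f2) = g" if "c1 * s1 - c2 * s2 = h" "c1 * f1 - c2 * f2 = g - h"
    for c1 c2 s1 s2 f1 f2 g h :: 'a
    using that by (simp add: algebra_simps)
  show ?case
    unfolding sum.atMost_Suc y_def[symmetric]
    by (rule rearr[OF Suc.IH], insert step) (simp add: W_def mult_ac)
qed

lemma well_poised_6phi5_sum:
  "(\<Sum>k\<le>M. (1 - \<alpha> * (Q ^ k)\<^sup>2) * ((\<Prod>j<k. 1 - \<alpha> * Q ^ j) ^ 2 * (\<Prod>j<k. 1 - \<beta> * Q ^ j)
        / ((\<Prod>j<k. 1 - Q * Q ^ j) ^ 2 * (\<Prod>j<k. 1 - \<alpha> * Q / \<beta> * Q ^ j))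
        * (Q / \<beta>) ^ k * (\<Prod>j<k. Q ^ M - Q ^ j) / (\<Prod>j<k. 1 - \<alpha> * Q ^ (M + 1) * Q ^ j)))
    = (\<Prod>j<Suc M. 1 - \<alpha> * Q ^ j) * (\<Prod>j<M. 1 - Q / \<beta> * Q ^ j)
      / ((\<Prod>j<M. 1 - \<alpha> * Q / \<beta> * Q ^ j) * (\<Prod>j<M. 1 - Q * Q ^ j))"
proof -
  have "(\<Sum>k\<le>M. (1 - \<alpha> * (Q ^ k)\<^sup>2) * weight M k)
      = poch \<alpha> (Suc M) * poch (Q / \<beta>) M / (poch (\<alpha> * Q / \<beta>) M * poch Q M)"
  proof (induction M)
    case 0
    then show ?case by (simp add: weight_def poch_def)
  next
    case (Suc M)
    define p where "p = Q ^ Suc M"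
    let ?S = "\<lambda>M. \<Sum>k\<le>M. (1 - \<alpha> * (Q ^ k)\<^sup>2) * weight M k"
    \<comment> \<open>The product over j < M + 1 contains Q^M - Q^M. At N = M + 1 the boundary term
      therefore vanishes, and the extra summand for M contributes nothing.\<close>
    have "weight M (Suc M) = 0" by (simp add: weight_def)
    then have "(1 - \<alpha> * p / \<beta>) * (1 - p) * ?S (Suc M) = (1 - \<alpha> * p) * (1 - p / \<beta>) * ?S M"
      using weight_telescope[of M "Suc M"] by (simp add: p_def)
    moreover have "1 - \<alpha> * p / \<beta> \<noteq> 0" "1 - p \<noteq> 0"
      using \<beta>(1) \<beta>(2)[of "Suc M"] Q(2)[of "Suc M"] by (auto simp: p_def field_simps)
    ultimately have "?S (Suc M) = (1 - \<alpha> * p) * (1 - p / \<beta>) * ?S M / ((1 - \<alpha> * p / \<beta>) * (1 - p))"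
      by (subst nonzero_eq_divide_eq) (auto simp: mult_ac)
    also have "\<dots> = poch \<alpha> (Suc (Suc M)) * poch (Q / \<beta>) (Suc M)
        / (poch (\<alpha> * Q / \<beta>) (Suc M) * poch Q (Suc M))"
      unfolding Suc.IH poch_Suc[of _ "Suc M"] poch_Suc[of "Q / \<beta>"] poch_Suc[of "\<alpha> * Q / \<beta>"] poch_Suc[of Q]
      by (simp add: p_def mult_ac)
    finally show ?case .
  qed
  then show ?thesis by (simp only: weight_def poch_def)
qed

end

subsection \<open>Valuations of shifted products\<close>

text \<open>The shifted factorial (q^s;q^d)_k, indexed by the exponent s instead of the value q^s,
  so that divisibility of the exponents s + dj by m can be followed.\<close>

definition qprod :: "nat \<Rightarrow> int \<Rightarrow> nat \<Rightarrow> ratfun" where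
  "qprod d s k = (\<Prod>j<k. 1 - qvar powi (s + int d * int j))"

lemma qprod_0 [simp]: "qprod d s 0 = 1"
  by (simp add: qprod_def)

lemma qprod_Suc: "qprod d s (Suc k) = qprod d s k * (1 - qvar powi (s + int d * int k))"
  by (simp add: qprod_def)

lemma qprod_add: "qprod d s (k + l) = qprod d s k * qprod d (s + int d * int k) l"
proof (induction l)
  case (Suc l)
  have "s + int d * int (k + l) = s + int d * int k + int d * int l"
    by (simp add: distrib_left)
  then show ?case by (simp only: add_Suc_right qprod_Suc Suc.IH mult.assoc)
qed simp

lemma qprod_nonzero: "(\<And>j. j < k \<Longrightarrow> s + int d * int j \<noteq> 0) \<Longrightarrow> qprod d s k \<noteq> 0"
  by (auto simp: qprod_def)

lemma qprod_base_nonzero: "d > 0 \<Longrightarrow> qprod d (int d) k \<noteq> 0"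
proof (rule qprod_nonzero)
  fix j assume "d > 0"
  then have "int d + int d * int j > 0" by (simp add: add_pos_nonneg)
  then show "int d + int d * int j \<noteq> 0" by simp
qed

abbreviation hits :: "nat \<Rightarrow> nat \<Rightarrow> int \<Rightarrow> nat \<Rightarrow> nat set" where
  "hits m d s k \<equiv> {j. j < k \<and> int m dvd s + int d * int j}"

context
  fixes m :: nat
  assumes m: "m > 1"
begin

text \<open>Each exponent divisible by m contributes one factor 1 - q^m, up to a unit if the
  exponent is nonzero; the remaining factors are units. A zero exponent makes the product zero,
  which is why x is only integral in general.\<close>

lemma qprod_valuation:
  "\<exists>x \<in> loc_ideal (cyclotomic m) 0. qprod d s k = (1 - qvar ^ m) ^ card (hits m d s k) * x
     \<and> ((\<forall>j<k. s + int d * int j \<noteq> 0) \<longrightarrow> x \<in> loc_unit (cyclotomic m))"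
proof (induction k)
  case 0
  then show ?case by (auto intro: loc_ideal_1 loc_unit_1)
next
  case (Suc k)
  define e where "e = s + int d * int k"
  define w where "w = 1 - qvar ^ m"
  from Suc obtain x where x: "x \<in> loc_ideal (cyclotomic m) 0"
    "qprod d s k = w ^ card (hits m d s k) * x"
    "(\<forall>j<k. s + int d * int j \<noteq> 0) \<longrightarrow> x \<in> loc_unit (cyclotomic m)"
    unfolding w_def by blast
  have w: "w \<noteq> 0" using m qvar_power_eq_1_iff[of m] by (auto simp: w_def)
  show ?case
  proof (cases "int m dvd e")
    case True
    then have "hits m d s (Suc k) = insert k (hits m d s k)"
      by (auto simp: e_def less_Suc_eq)
    then have "card (hits m d s (Suc k)) = Suc (card (hits m d s k))" by simp
    then have "qprod d s (Suc k) = w ^ card (hits m d s (Suc k)) * (x * ((1 - qvar powi e) / w))"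
      using w by (simp add: qprod_Suc x(2) e_def)
    moreover have "x * ((1 - qvar powi e) / w) \<in> loc_ideal (cyclotomic m) 0"
      unfolding w_def using m True x(1) by (intro loc_ideal_mult_left qvar_quotient_integral)
    moreover have "x * ((1 - qvar powi e) / w) \<in> loc_unit (cyclotomic m)"
      if "\<forall>j<Suc k. s + int d * int j \<noteq> 0"
      unfolding w_def using m True x(3) that
      by (intro loc_unit_mult qvar_quotient_unit) (auto simp: e_def)
    ultimately show ?thesis unfolding w_def by blast
  next
    case False
    then have "hits m d s (Suc k) = hits m d s k"
      by (auto simp: e_def less_Suc_eq)
    then have "qprod d s (Suc k) = w ^ card (hits m d s (Suc k)) * (x * (1 - qvar powi e))"
      by (simp add: qprod_Suc x(2) e_def)
    moreover have "x * (1 - qvar powi e) \<in> loc_ideal (cyclotomic m) 0"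
      using m x(1) by (intro loc_ideal_mult_left one_minus_qvar_powi_integral)
    moreover have "x * (1 - qvar powi e) \<in> loc_unit (cyclotomic m)"
      if "\<forall>j<Suc k. s + int d * int j \<noteq> 0"
      using m False x(3) that by (intro loc_unit_mult one_minus_qvar_powi_unit) auto
    ultimately show ?thesis unfolding w_def by blast
  qed
qed

lemma card_hits_ge:
  assumes "int m dvd s + int d * int r" "\<And>i. i < c \<Longrightarrow> r + i * m < k"
  shows "c \<le> card (hits m d s k)"
proof -
  have "inj_on (\<lambda>i. r + i * m) {..<c}" using m by (auto simp: inj_on_def)
  moreover have "(\<lambda>i. r + i * m) ` {..<c} \<subseteq> hits m d s k"
  proof clarify
    fix i assume "i < c"
    have eq: "s + int d * int (r + i * m) = (s + int d * int r) + int m * (int d * int i)"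
      by (simp add: algebra_simps)
    have "int m dvd s + int d * int (r + i * m)"
      unfolding eq by (rule dvd_add[OF assms(1) dvd_triv_left])
    then show "r + i * m < k \<and> int m dvd s + int d * int (r + i * m)"
      using assms(2)[OF \<open>i < c\<close>] by blast
  qed
  ultimately have "card {..<c} \<le> card (hits m d s k)" by (intro card_inj_on_le) auto
  then show ?thesis by simp
qed

context
  fixes d :: nat
  assumes d: "coprime m d" "d > 0"
begin

text \<open>As m is coprime to d, it divides d(j+1) exactly when it divides j + 1.\<close>

lemma card_hits_base: "card (hits m d (int d) k) = k div m"
proof (induction k)
  case (Suc k)
  have "int m dvd int d + int d * int k \<longleftrightarrow> m dvd d * Suc k"
    by (simp flip: int_dvd_int_iff add: distrib_left)
  also have "\<dots> \<longleftrightarrow> m dvd Suc k"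
    using d(1) by (rule coprime_dvd_mult_right_iff)
  finally have *: "int m dvd int d + int d * int k \<longleftrightarrow> m dvd Suc k" .
  have "hits m d (int d) (Suc k)
      = (if m dvd Suc k then insert k (hits m d (int d) k) else hits m d (int d) k)"
    using * by (auto simp: less_Suc_eq)
  then show ?case using Suc by (simp add: div_Suc dvd_eq_mod_eq_0)
qed simp

text \<open>The denominator contains 1 - q^m exactly k div m times, so a surplus of i hits in the
  numerator survives as i factors 1 - q^m.\<close>

lemma qprod_ratio:
  assumes "k div m + i \<le> card (hits m d s k)"
  shows "qprod d s k / qprod d (int d) k \<in> loc_ideal (cyclotomic m) i"
proof -
  define w where "w = 1 - qvar ^ m"
  have w: "w \<noteq> 0" using m qvar_power_eq_1_iff[of m] by (auto simp: w_def)
  have w1: "w \<in> loc_ideal (cyclotomic m) 1"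
    using one_minus_qvar_powi_ideal[OF m, of "int m"] by (simp add: w_def)
  obtain x where x: "x \<in> loc_ideal (cyclotomic m) 0" "qprod d s k = w ^ card (hits m d s k) * x"
    using qprod_valuation[of d s k] unfolding w_def by blast
  have pos: "int d + int d * int j \<noteq> 0" for j
    using d(2) by (simp add: add_pos_nonneg less_imp_neq[symmetric])
  obtain y where y: "y \<in> loc_unit (cyclotomic m)" "qprod d (int d) k = w ^ (k div m) * y"
    using qprod_valuation[of d "int d" k] pos unfolding w_def card_hits_base by blast
  obtain l where l: "card (hits m d s k) = k div m + (i + l)"
    using assms by (metis add.assoc le_add_diff_inverse)
  have "qprod d s k / qprod d (int d) k = w ^ (i + l) * x / y"
    using w by (simp add: x(2) y(2) l power_add)
  also have "w ^ (i + l) \<in> loc_ideal (cyclotomic m) i"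
    using loc_ideal_power[OF w1, of "i + l"] by (auto intro: loc_ideal_mono)
  then have "w ^ (i + l) * x / y \<in> loc_ideal (cyclotomic m) i"
    using x(1) y(1) by (intro loc_ideal_divide_unit loc_ideal_mult_right)
  finally show ?thesis .
qed

lemma root_exists: "\<exists>r<m. int m dvd s + int d * int r"
proof -
  obtain x where x: "[int d * x = 1] (mod int m)"
    using d(1) cong_solve_coprime_int[of "int d" "int m"] by (auto simp: coprime_commute)
  define r where "r = nat ((- s * x) mod int m)"
  have r: "int r = (- s * x) mod int m" using m by (simp add: r_def)
  have "[int d * int r = int d * (- s * x)] (mod int m)"
    unfolding r by (intro cong_scalar_left) (simp add: cong_def)
  also have "int d * (- s * x) = - s * (int d * x)" by simp
  also have "[- s * (int d * x) = - s * 1] (mod int m)" using x by (rule cong_scalar_left)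
  finally have "[s + int d * int r = s + - s * 1] (mod int m)" by (intro cong_add cong_refl)
  then have "int m dvd s + int d * int r" by (simp add: cong_0_iff)
  moreover have "r < m"
    using r m pos_mod_bound[of "int m" "- s * x"] by linarith
  ultimately show ?thesis by blast
qed

text \<open>Every complete block of m consecutive indices contains a hit, so the numerator has at
  least k div m of them.\<close>

lemma qprod_ratio_integral: "qprod d s k / qprod d (int d) k \<in> loc_ideal (cyclotomic m) 0"
proof -
  obtain r where r: "r < m" "int m dvd s + int d * int r" using root_exists by blast
  have "r + i * m < k" if "i < k div m" for i
  proof -
    have "r + i * m < Suc i * m" using r(1) by simp
    also have "\<dots> \<le> k div m * m" using that by (intro mult_right_mono) auto
    also have "\<dots> \<le> k" by (rule div_times_less_eq_dividend)
    finally show ?thesis .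
  qed
  then show ?thesis using r(2) by (intro qprod_ratio) (auto intro: card_hits_ge)
qed

text \<open>The incomplete last block reaches beyond its root r, which gives one hit more than the
  denominator has.\<close>

lemma qprod_ratio_divisible:
  assumes "int m dvd s + int d * int r" "r < k mod m"
  shows "qprod d s k / qprod d (int d) k \<in> loc_ideal (cyclotomic m) 1"
proof -
  have "r + i * m < k" if "i < k div m + 1" for i
  proof -
    have "i * m \<le> k div m * m" using that by (intro mult_right_mono) auto
    then show ?thesis using assms(2) div_mult_mod_eq[of k m] by linarith
  qed
  then show ?thesis using assms(1) by (intro qprod_ratio card_hits_ge)
qed

end

end

subsection \<open>Antisymmetry of the summands\<close>

text \<open>The summand multiplied by 1 - q. This factor is a unit at every cyclotomic polynomial of
  index above 1 and is divided out again only in the final theorem.\<close>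

definition wp_term :: "nat \<Rightarrow> int \<Rightarrow> nat \<Rightarrow> ratfun" where
  "wp_term d t k = (1 - qvar powi (t + 2 * int d * int k))
     * (qprod d t k / qprod d (int d) k) ^ 4 * qvar powi ((int d - 2 * t) * int k)"

text \<open>Up to sign and a power of q, the quotient of (q^(-dr);q^d)_b by (q^d;q^d)_b is a
  Gaussian binomial coefficient; its symmetry under b to r - b underlies the antisymmetry of the
  summands.\<close>

lemma qprod_reversal:
  assumes "b \<le> r"
  shows "qprod d (- (int d * int r)) b * qprod d (int d) (r - b)
       = (\<Prod>j<b. - (qvar powi (int d * (int j - int r)))) * qprod d (int d) r"
  using assms
proof (induction b)
  case (Suc b)
  define e where "e = int d * (int r - int b)"
  have 1: "qprod d (- (int d * int r)) (Suc b) = qprod d (- (int d * int r)) b * (1 - qvar powi (- e))"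
    by (simp add: qprod_Suc e_def algebra_simps)
  have "r - b = Suc (r - Suc b)" using Suc.prems by simp
  moreover have "int d + int d * int (r - Suc b) = e"
    using Suc.prems by (simp add: e_def of_nat_diff algebra_simps)
  ultimately have 2: "qprod d (int d) (r - b) = qprod d (int d) (r - Suc b) * (1 - qvar powi e)"
    by (simp add: qprod_Suc)
  have 3: "int d * (int b - int r) = - e" by (simp add: e_def algebra_simps)
  have "qprod d (- (int d * int r)) (Suc b) * qprod d (int d) (r - Suc b)
      = - (qvar powi (- e)) * (qprod d (- (int d * int r)) b * qprod d (int d) (r - b))"
    unfolding 1 2 one_minus_qvar_powi_uminus[of e] by (simp only: mult_ac)
  also have "\<dots> = (\<Prod>j<Suc b. - (qvar powi (int d * (int j - int r)))) * qprod d (int d) r"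
    using Suc by (simp add: 3)
  finally show ?case .
qed simp

text \<open>The fourth power removes the signs and makes the exponent 4d times the sum of j - r over
  j < b.\<close>

lemma prod_reversal_power4:
  "(\<Prod>j<b. - (qvar powi (int d * (int j - int r)))) ^ 4
   = qvar powi (2 * int d * (int b * int b - int b - 2 * int r * int b))"
proof (induction b)
  case (Suc b)
  have "(- (qvar powi (int d * (int b - int r)))) ^ 4 = qvar powi (int d * (int b - int r) * 4)"
    by (simp add: power_int_mult)
  then have "(\<Prod>j<Suc b. - (qvar powi (int d * (int j - int r)))) ^ 4
      = qvar powi (2 * int d * (int b * int b - int b - 2 * int r * int b)
          + int d * (int b - int r) * 4)"
    by (simp add: power_mult_distrib Suc.IH power_int_add)
  also have "2 * int d * (int b * int b - int b - 2 * int r * int b) + int d * (int b - int r) * 4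
      = 2 * int d * (int (Suc b) * int (Suc b) - int (Suc b) - 2 * int r * int (Suc b))"
    by (simp add: algebra_simps)
  finally show ?case .
qed simp

text \<open>The term equals (q^(y b) - q^(y (r - b))) B b, where B is the fourth power of a Gaussian
  binomial coefficient and hence symmetric, while the bracket changes sign.\<close>

lemma wp_term_antisymmetric:
  assumes "b \<le> r" "d > 0"
  shows "wp_term d (- (int d * int r)) (r - b) = - wp_term d (- (int d * int r)) b"
proof -
  define B where "B b = (qprod d (int d) r / (qprod d (int d) b * qprod d (int d) (r - b))) ^ 4" for b
  define y where "y b = 2 * int d * (int b * int b - int b - 2 * int r * int b)
    + (int d + 2 * (int d * int r)) * int b" for b
  have *: "wp_term d (- (int d * int r)) b
      = (qvar powi y b - qvar powi (y b + (2 * int d * int b - int d * int r))) * B b" if "b \<le> r" for b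
  proof -
    have "qprod d (- (int d * int r)) b
        = (\<Prod>j<b. - (qvar powi (int d * (int j - int r)))) * (qprod d (int d) r / qprod d (int d) (r - b))"
      using qprod_reversal[OF that, of d] qprod_base_nonzero[OF assms(2), of "r - b"]
      by (simp add: field_simps)
    then have ratio: "(qprod d (- (int d * int r)) b / qprod d (int d) b) ^ 4
        = qvar powi (2 * int d * (int b * int b - int b - 2 * int r * int b)) * B b"
      unfolding prod_reversal_power4[symmetric] B_def
      by (simp add: power_mult_distrib power_divide)
    define u v z where "u = 2 * int d * (int b * int b - int b - 2 * int r * int b)"
      and "v = (int d + 2 * (int d * int r)) * int b" and "z = 2 * int d * int b - int d * int r"
    have "wp_term d (- (int d * int r)) b = (1 - qvar powi z) * (qvar powi u * B b) * qvar powi v"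
      unfolding wp_term_def ratio u_def v_def z_def by simp
    also have "\<dots> = (qvar powi (u + v) - qvar powi (u + v + z)) * B b"
      by (simp add: power_int_add left_diff_distrib right_diff_distrib mult_ac)
    finally show ?thesis by (simp only: y_def u_def v_def z_def)
  qed
  have B: "B (r - b) = B b" using assms(1) by (simp add: B_def mult.commute)
  have y1: "y (r - b) = y b + (2 * int d * int b - int d * int r)"
    using assms(1) by (simp add: y_def of_nat_diff algebra_simps)
  have y2: "y (r - b) + (2 * int d * int (r - b) - int d * int r) = y b"
    using assms(1) by (simp add: y_def of_nat_diff algebra_simps)
  have "wp_term d (- (int d * int r)) (r - b)
      = (qvar powi y (r - b) - qvar powi (y (r - b) + (2 * int d * int (r - b) - int d * int r))) * B (r - b)"
    by (rule *) simp
  also have "\<dots> = - wp_term d (- (int d * int r)) b"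
    unfolding y2 B *[OF assms(1)] unfolding y1 by (simp add: left_diff_distrib)
  finally show ?thesis .
qed

text \<open>Pairing summands yields twice a sum, and this allows the factor 2 to be
  cancelled.\<close>

lemma two_loc_unit: "2 \<in> loc_unit P" for P :: "rat poly"
proof -
  have "2 dvd (1 :: rat poly)"
    using dvd_triv_left[of "2 :: rat poly" "[:1/2:]"] by (simp add: numeral_poly one_pCons)
  then have "to_fract 2 \<in> loc_unit P"
    by (intro to_fract_loc_unit is_unit_left_imp_coprime) auto
  moreover have "to_fract (2 :: rat poly) = 2"
    using to_fract_add[of "1 :: rat poly" 1] by simp
  ultimately show ?thesis by simp
qed

section \<open>Vanishing of the sum modulo one cyclotomic polynomial\<close>

context
  fixes m d :: nat
  assumes m: "m > 1" and d: "coprime m d" "d > 0"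
begin

lemma wp_term_integral: "wp_term d s k \<in> loc_ideal (cyclotomic m) 0"
  unfolding wp_term_def
  by (intro loc_ideal_mult_left loc_ideal_power_0 one_minus_qvar_powi_integral[OF m]
      qprod_ratio_integral[OF m d] loc_unit_ideal[OF qvar_powi_unit[OF m]])

context
  fixes r :: nat and t :: int
  assumes r: "r < m" "int m dvd t + int d * int r"
begin

lemma wp_term_divisible:
  assumes "r < k mod m"
  shows "wp_term d t k \<in> loc_ideal (cyclotomic m) 4"
proof -
  have "(qprod d t k / qprod d (int d) k) ^ 4 \<in> loc_ideal (cyclotomic m) (4 * 1)"
    by (intro loc_ideal_power qprod_ratio_divisible[OF m d r(2) assms])
  then show ?thesis
    unfolding wp_term_def
    by (intro loc_ideal_mult_right loc_ideal_mult_left one_minus_qvar_powi_integral[OF m]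
        loc_unit_ideal[OF qvar_powi_unit[OF m]]) simp
qed

text \<open>Splitting off the first a m factors of each product leaves b factors whose exponents
  agree modulo m with those for a = 0 and t = -dr. The constant depends only on the block a, so the
  exact antisymmetry can be used inside each block.\<close>

lemma wp_term_reduce:
  assumes "b \<le> r"
  shows "wp_term d t (a * m + b)
     - (qprod d t (a * m) / qprod d (int d) (a * m)) ^ 4 * wp_term d (- (int d * int r)) b
     \<in> loc_ideal (cyclotomic m) 1" (is "_ - ?c ^ 4 * _ \<in> ?I")
proof -
  obtain u where u: "t = int m * u - int d * int r" using r(2) by (metis add_diff_cancel_right' dvdE)
  let ?s = "t + int d * int (a * m)" and ?e = "int d + int d * int (a * m)"
  \<comment> \<open>Since j + 1 <= b <= r < m, none of these denominator factors has an exponent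
    divisible by m.\<close>
  have unit: "1 - qvar powi (f + int d * int j) \<in> loc_unit (cyclotomic m)"
    if "f = int d \<or> f = ?e" "j < b" for f j
  proof (rule one_minus_qvar_powi_unit[OF m])
    have "\<not> m dvd Suc j" using that(2) assms r(1) by (auto dest: dvd_imp_le)
    then have "\<not> m dvd d * Suc j" using coprime_dvd_mult_right_iff[OF d(1)] by blast
    moreover have "int d + int d * int j = int (d * Suc j)" by (simp add: distrib_left)
    ultimately have "\<not> int m dvd int d + int d * int j" by (simp only: int_dvd_int_iff not_False_eq_True)
    moreover have "?e + int d * int j = int d + int d * int j + int m * (int d * int a)"
      by (simp add: algebra_simps)
    then have "int m dvd ?e + int d * int j \<longleftrightarrow> int m dvd int d + int d * int j"
      by (simp only:) (rule dvd_add_left_iff, rule dvd_triv_left)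
    ultimately show "\<not> int m dvd f + int d * int j" using that(1) by blast
  qed
  have "qprod d ?s b - qprod d (- (int d * int r)) b \<in> ?I"
    unfolding qprod_def
  proof (intro loc_ideal_prod_cong one_minus_qvar_powi_integral[OF m])
    fix j
    have "- (int d * int r) + int d * int j - (?s + int d * int j) = int m * (- u - int d * int a)"
      by (simp add: u algebra_simps)
    then have "int m dvd - (int d * int r) + int d * int j - (?s + int d * int j)" by simp
    from qvar_powi_cong[OF m this]
    show "1 - qvar powi (?s + int d * int j) - (1 - qvar powi (- (int d * int r) + int d * int j)) \<in> ?I"
      by simp
  qed
  moreover have "qprod d ?e b - qprod d (int d) b \<in> ?I"
    unfolding qprod_def
  proof (intro loc_ideal_prod_cong one_minus_qvar_powi_integral[OF m])
    fix j
    have "int d + int d * int j - (?e + int d * int j) = int m * (- (int d * int a))"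
      by (simp add: algebra_simps)
    then have "int m dvd int d + int d * int j - (?e + int d * int j)" by simp
    from qvar_powi_cong[OF m this]
    show "1 - qvar powi (?e + int d * int j) - (1 - qvar powi (int d + int d * int j)) \<in> ?I"
      by simp
  qed
  moreover have int: "qprod d s b \<in> loc_ideal (cyclotomic m) 0" for s
    unfolding qprod_def by (intro loc_ideal_prod one_minus_qvar_powi_integral[OF m])
  moreover have units: "qprod d ?e b \<in> loc_unit (cyclotomic m)" "qprod d (int d) b \<in> loc_unit (cyclotomic m)"
    using unit unfolding qprod_def by (auto intro!: loc_unit_prod)
  ultimately have "qprod d ?s b / qprod d ?e b - qprod d (- (int d * int r)) b / qprod d (int d) b \<in> ?I"
    by (intro loc_ideal_divide_cong)
  then have "?c * (qprod d ?s b / qprod d ?e b)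
      - ?c * (qprod d (- (int d * int r)) b / qprod d (int d) b) \<in> ?I"
    unfolding right_diff_distrib[symmetric]
    by (intro loc_ideal_mult_left qprod_ratio_integral[OF m d])
  then have "qprod d t (a * m + b) / qprod d (int d) (a * m + b)
      - ?c * (qprod d (- (int d * int r)) b / qprod d (int d) b) \<in> ?I"
    by (simp add: qprod_add)
  then have ratio: "(qprod d t (a * m + b) / qprod d (int d) (a * m + b)) ^ 4
      - (?c * (qprod d (- (int d * int r)) b / qprod d (int d) b)) ^ 4 \<in> ?I"
    by (intro loc_ideal_power_cong loc_ideal_mult_left qprod_ratio_integral[OF m d])
  have "- (int d * int r) + 2 * int d * int b - (t + 2 * int d * int (a * m + b))
      = int m * (- u - 2 * int d * int a)"
    by (simp add: u algebra_simps)
  then have "int m dvd - (int d * int r) + 2 * int d * int b - (t + 2 * int d * int (a * m + b))"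
    by simp
  from qvar_powi_cong[OF m this]
  have bracket: "(1 - qvar powi (t + 2 * int d * int (a * m + b)))
      - (1 - qvar powi (- (int d * int r) + 2 * int d * int b)) \<in> ?I" by simp
  have "(int d - 2 * t) * int (a * m + b) - (int d - 2 * (- (int d * int r))) * int b
      = int m * ((int d - 2 * t) * int a - 2 * u * int b)"
    by (simp add: u algebra_simps)
  then have "int m dvd (int d - 2 * t) * int (a * m + b) - (int d - 2 * (- (int d * int r))) * int b"
    by simp
  from qvar_powi_cong[OF m this]
  have pow: "qvar powi ((int d - 2 * t) * int (a * m + b))
      - qvar powi ((int d - 2 * (- (int d * int r))) * int b) \<in> ?I" .
  have "wp_term d t (a * m + b) - (1 - qvar powi (- (int d * int r) + 2 * int d * int b))
      * (?c * (qprod d (- (int d * int r)) b / qprod d (int d) b)) ^ 4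
      * qvar powi ((int d - 2 * (- (int d * int r))) * int b) \<in> ?I"
    unfolding wp_term_def
    by (intro loc_ideal_mult_cong bracket ratio pow loc_ideal_mult_left loc_ideal_power_0
        one_minus_qvar_powi_integral[OF m] qprod_ratio_integral[OF m d]
        loc_unit_ideal[OF qvar_powi_unit[OF m]])
  moreover have "x * (c * y) ^ 4 * z = c ^ 4 * (x * y ^ 4 * z)" for x y z c :: ratfun
    by (simp add: power_mult_distrib mult_ac)
  ultimately show ?thesis unfolding wp_term_def[of d "- (int d * int r)" b] by (simp only:)
qed

text \<open>Within each block the residues up to r cancel in pairs and the terms of larger residue
  vanish. The condition on K ensures that the last block contains all residues up to r, so that no
  pair is cut.\<close>

lemma wp_sum_divisible:
  assumes K: "r \<le> K mod m"
  shows "(\<Sum>k\<le>K. wp_term d t k) \<in> loc_ideal (cyclotomic m) 1" (is "_ \<in> ?I")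
proof -
  define X where "X = {k. k \<le> K \<and> k mod m \<le> r}"
  \<comment> \<open>The reflection b to r - b of residues, block by block. A possible fixed point is
    harmless because the sum is doubled before it is paired.\<close>
  define \<sigma> where "\<sigma> k = k div m * m + (r - k mod m)" for k
  have \<sigma>: "\<sigma> k div m = k div m" "\<sigma> k mod m = r - k mod m" for k
    using r(1) by (simp_all add: \<sigma>_def)
  have \<sigma>_mem: "\<sigma> k \<in> X" if "k \<in> X" for k
  proof -
    have "k div m \<le> K div m" using that by (auto simp: X_def intro: div_le_mono)
    then consider "k div m = K div m" | "Suc (k div m) \<le> K div m" by linarith
    then have "\<sigma> k \<le> K"
    proof cases
      case 1
      have "\<sigma> k \<le> K div m * m + K mod m"
        unfolding \<sigma>_def 1 using K by (intro add_left_mono) linarith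
      then show ?thesis by simp
    next
      case 2
      have "\<sigma> k \<le> Suc (k div m) * m" using r(1) by (simp add: \<sigma>_def)
      also have "\<dots> \<le> K div m * m" using 2 by (rule mult_right_mono) simp
      also have "\<dots> \<le> K" by (rule div_times_less_eq_dividend)
      finally show ?thesis .
    qed
    then show ?thesis by (simp add: X_def \<sigma>)
  qed
  have \<sigma>_inv: "\<sigma> (\<sigma> k) = k" if "k \<in> X" for k
  proof -
    have "\<sigma> (\<sigma> k) = k div m * m + (r - (r - k mod m))" by (simp add: \<sigma>_def[of "\<sigma> k"] \<sigma>)
    then show ?thesis using that by (simp add: X_def)
  qed
  have pair: "wp_term d t k + wp_term d t (\<sigma> k) \<in> ?I" if "k \<in> X" for k
  proof -
    let ?c = "(qprod d t (k div m * m) / qprod d (int d) (k div m * m)) ^ 4"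
    let ?b = "k mod m"
    have b: "?b \<le> r" using that by (simp add: X_def)
    have "wp_term d t k - ?c * wp_term d (- (int d * int r)) ?b \<in> ?I"
      using wp_term_reduce[OF b, of "k div m"] by simp
    moreover have "wp_term d t (\<sigma> k) - ?c * wp_term d (- (int d * int r)) (r - ?b) \<in> ?I"
      using wp_term_reduce[of "r - ?b" "k div m"] by (simp add: \<sigma>_def)
    ultimately show ?thesis
      using loc_ideal_add unfolding wp_term_antisymmetric[OF b d(2)] by fastforce
  qed
  have "(\<Sum>k\<in>X. wp_term d t k) = (\<Sum>k\<in>X. wp_term d t (\<sigma> k))"
    by (rule sum.reindex_bij_witness[of _ \<sigma> \<sigma>]) (auto simp: \<sigma>_mem \<sigma>_inv)
  then have "2 * (\<Sum>k\<in>X. wp_term d t k) = (\<Sum>k\<in>X. wp_term d t k + wp_term d t (\<sigma> k))"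
    by (simp add: sum.distrib)
  also have "\<dots> \<in> ?I" by (intro loc_ideal_sum pair)
  finally have "2 * (\<Sum>k\<in>X. wp_term d t k) / 2 \<in> ?I"
    by (rule loc_ideal_divide_unit) (rule two_loc_unit)
  then have 1: "(\<Sum>k\<in>X. wp_term d t k) \<in> ?I"
    using loc_unit_nonzero[OF two_loc_unit] by simp
  have 2: "(\<Sum>k\<in>{..K} - X. wp_term d t k) \<in> ?I"
  proof (rule loc_ideal_sum)
    fix k assume "k \<in> {..K} - X"
    then have "r < k mod m" by (auto simp: X_def)
    then show "wp_term d t k \<in> ?I" by (rule loc_ideal_mono[OF wp_term_divisible]) simp
  qed
  have "(\<Sum>k\<le>K. wp_term d t k) = (\<Sum>k\<in>{..K} - X. wp_term d t k) + (\<Sum>k\<in>X. wp_term d t k)"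
    by (rule sum.subset_diff) (auto simp: X_def)
  then show ?thesis using loc_ideal_add[OF 2 1] by simp
qed

end

end

subsection \<open>The perturbed sum\<close>

text \<open>Taken in reverse order, the factors on the left have the exponents -(s + d i). This
  turns the products of the 6-phi-5 value into those of the claimed right-hand side.\<close>

lemma qprod_reversal_neg:
  "qprod d (int d - s - int d * int M) M = (\<Prod>i<M. - (qvar powi (- (s + int d * int i)))) * qprod d s M"
proof -
  have "qprod d (int d - s - int d * int M) M
      = (\<Prod>i<M. 1 - qvar powi (int d - s - int d * int M + int d * int (M - Suc i)))"
    unfolding qprod_def by (rule prod.nat_diff_reindex[symmetric])
  also have "\<dots> = (\<Prod>i<M. - (qvar powi (- (s + int d * int i))) * (1 - qvar powi (s + int d * int i)))"
  proof (rule prod.cong)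
    fix i assume "i \<in> {..<M}"
    then have "int d - s - int d * int M + int d * int (M - Suc i) = - (s + int d * int i)"
      by (simp add: of_nat_diff algebra_simps)
    then show "1 - qvar powi (int d - s - int d * int M + int d * int (M - Suc i))
        = - (qvar powi (- (s + int d * int i))) * (1 - qvar powi (s + int d * int i))"
      by (simp only: one_minus_qvar_powi_uminus)
  qed simp
  finally show ?thesis by (simp only: qprod_def prod.distrib)
qed

lemma qvar_powi_mult: "qvar powi a * qvar powi b = qvar powi (a + b)"
  by (simp add: power_int_add)

lemma qvar_powi_divide: "qvar powi a / qvar powi b = qvar powi (a - b)"
  by (simp add: power_int_diff)

text \<open>The perturbed summand at x = q^n: the shifts by n and -n are the multiplications by x
  and 1/x.\<close>

definition wp_term_shift :: "nat \<Rightarrow> int \<Rightarrow> int \<Rightarrow> nat \<Rightarrow> ratfun" where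
  "wp_term_shift d t n k = (1 - qvar powi (t + 2 * int d * int k))
     * (qprod d t k ^ 2 * qprod d (t + n) k * qprod d (t - n) k
        / (qprod d (int d) k ^ 2 * qprod d (int d - n) k * qprod d (int d + n) k))
     * qvar powi ((int d - 2 * t) * int k)"

lemma qprod_conv:
  assumes "x = qvar powi s" "y = qvar ^ d"
  shows "(\<Prod>j<k. 1 - x * y ^ j) = qprod d s k"
proof -
  have "(qvar ^ d) ^ j = qvar powi (int d * int j)" for j
    by (metis of_nat_mult power_int_of_nat power_mult)
  then show ?thesis by (simp add: qprod_def assms power_int_add)
qed

text \<open>The 6-phi-5 sum with Q = q^d, \<alpha> = q^t and \<beta> = q^(t+n). From n = t + dM one
  gets Q^(-M) = q^(t-n) and \<alpha> Q^(M+1) = q^(d+n). That d does not divide t keeps the exponents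
  t + d i, and with them the denominators, from vanishing.\<close>

lemma sum_wp_term_shift:
  assumes n: "n = t + int d * int M" and d: "d > 0" and t: "\<not> int d dvd t"
  shows "(\<Sum>k\<le>M. wp_term_shift d t n k)
    = qprod d (2 * t) M / qprod d (int d) M * (1 - qvar powi n) * qvar powi (- (t * int M))"
proof -
  define Q where "Q = qvar ^ d"
  define \<alpha> where "\<alpha> = qvar powi t"
  define \<beta> where "\<beta> = qvar powi (t + n)"
  have Qpow: "Q ^ j = qvar powi (int d * int j)" for j
    unfolding Q_def by (metis of_nat_mult power_int_of_nat power_mult)
  have Q': "Q = qvar powi (int d)" by (simp add: Q_def)
  have t': "t + int d * i \<noteq> 0" for i
    using t by (metis add.commute add_diff_cancel_right' dvd_0_right dvd_add_right_iff dvd_triv_left)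
  have 1: "Q \<noteq> 0" by (simp add: Q_def)
  have 2: "Q ^ j \<noteq> 1" if "j > 0" for j using that d by (simp add: Qpow)
  have 3: "\<alpha> * Q ^ j \<noteq> 1" for j
    unfolding \<alpha>_def Qpow using t'[of "int j"] by (simp add: power_int_add[symmetric])
  have 4: "\<beta> \<noteq> 0" by (simp add: \<beta>_def)
  have 5: "\<alpha> * Q ^ j \<noteq> \<beta>" for j
  proof
    assume "\<alpha> * Q ^ j = \<beta>"
    then have "qvar powi (t + int d * int j) / qvar powi (t + n) = 1"
      by (simp add: \<alpha>_def \<beta>_def Qpow power_int_add)
    then have "t + int d * int j - (t + n) = 0"
      by (simp only: power_int_diff[symmetric] qvar_nonzero simp_thms) simp
    then show False using t'[of "int M - int j"] by (simp add: n algebra_simps)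
  qed
  have "\<alpha> * Q / \<beta> = qvar powi (t + int d - (t + n))"
    by (simp only: \<alpha>_def \<beta>_def Q' qvar_powi_mult qvar_powi_divide)
  also have "t + int d - (t + n) = int d - n" by simp
  finally have c1: "\<alpha> * Q / \<beta> = qvar powi (int d - n)" .
  have "\<alpha> * Q ^ (M + 1) = qvar powi (t + int d * int (M + 1))"
    by (simp only: \<alpha>_def Qpow qvar_powi_mult)
  also have "t + int d * int (M + 1) = int d + n" by (simp add: n algebra_simps)
  finally have c2: "\<alpha> * Q ^ (M + 1) = qvar powi (int d + n)" .
  have "Q / \<beta> = qvar powi (int d - (t + n))"
    by (simp only: \<beta>_def Q' qvar_powi_divide)
  also have "int d - (t + n) = int d - t - n" by simp
  finally have c3: "Q / \<beta> = qvar powi (int d - t - n)" .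
  have pw: "(Q / \<beta>) ^ k * (\<Prod>j<k. Q ^ M - Q ^ j)
      = qprod d (t - n) k * qvar powi ((int d - 2 * t) * int k)" for k
  proof -
    have "Q ^ M * qvar powi (t - n) = 1"
      unfolding Qpow qvar_powi_mult by (simp add: n)
    then have "Q ^ M - Q ^ j = Q ^ M * (1 - qvar powi (t - n) * Q ^ j)" for j
      by (simp add: right_diff_distrib mult.assoc[symmetric])
    then have "(\<Prod>j<k. Q ^ M - Q ^ j) = (Q ^ M) ^ k * qprod d (t - n) k"
      by (simp add: prod.distrib qprod_conv[OF refl Q_def, of "t - n", symmetric])
    moreover have "(Q / \<beta>) ^ k * (Q ^ M) ^ k = qvar powi ((int d - 2 * t) * int k)"
    proof -
      have "Q / \<beta> * Q ^ M = qvar powi (int d - 2 * t)"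
        unfolding c3 Qpow qvar_powi_mult by (simp add: n)
      then have "(Q / \<beta> * Q ^ M) ^ k = qvar powi ((int d - 2 * t) * int k)"
        by (simp add: power_int_mult)
      then show ?thesis by (simp only: power_mult_distrib)
    qed
    ultimately show ?thesis by (simp only: mult.assoc[symmetric]) (rule mult.commute)
  qed
  have "(\<Sum>k\<le>M. wp_term_shift d t n k)
      = (\<Sum>k\<le>M. (1 - \<alpha> * (Q ^ k)\<^sup>2) * ((\<Prod>j<k. 1 - \<alpha> * Q ^ j) ^ 2 * (\<Prod>j<k. 1 - \<beta> * Q ^ j)
        / ((\<Prod>j<k. 1 - Q * Q ^ j) ^ 2 * (\<Prod>j<k. 1 - \<alpha> * Q / \<beta> * Q ^ j))
        * (Q / \<beta>) ^ k * (\<Prod>j<k. Q ^ M - Q ^ j) / (\<Prod>j<k. 1 - \<alpha> * Q ^ (M + 1) * Q ^ j)))"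
  proof (rule sum.cong)
    fix k
    have sq: "\<alpha> * (Q ^ k)\<^sup>2 = qvar powi (t + 2 * int d * int k)"
      unfolding \<alpha>_def power2_eq_square Qpow qvar_powi_mult
      by (rule arg_cong[where f = "\<lambda>e. qvar powi e"]) simp
    have pw': "x / y * (Q / \<beta>) ^ k * (\<Prod>j<k. Q ^ M - Q ^ j) / z
      = x * qprod d (t - n) k / (y * z) * qvar powi ((int d - 2 * t) * int k)" for x y z
      unfolding mult.assoc[of "x / y"] pw by simp
    show "wp_term_shift d t n k
      = (1 - \<alpha> * (Q ^ k)\<^sup>2) * ((\<Prod>j<k. 1 - \<alpha> * Q ^ j) ^ 2 * (\<Prod>j<k. 1 - \<beta> * Q ^ j)
        / ((\<Prod>j<k. 1 - Q * Q ^ j) ^ 2 * (\<Prod>j<k. 1 - \<alpha> * Q / \<beta> * Q ^ j))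
        * (Q / \<beta>) ^ k * (\<Prod>j<k. Q ^ M - Q ^ j) / (\<Prod>j<k. 1 - \<alpha> * Q ^ (M + 1) * Q ^ j))"
      unfolding wp_term_shift_def pw' sq qprod_conv[OF \<alpha>_def Q_def] qprod_conv[OF \<beta>_def Q_def]
        qprod_conv[OF Q' Q_def] qprod_conv[OF c1 Q_def] qprod_conv[OF c2 Q_def]
      by (rule mult.assoc)
  qed simp
  also have "\<dots> = qprod d t (Suc M) * qprod d (int d - t - n) M
      / (qprod d (int d - n) M * qprod d (int d) M)"
    using well_poised_6phi5_sum[of Q \<alpha> \<beta> M, OF 1 2 3 4 5]
    by (simp only: qprod_conv[OF \<alpha>_def Q_def] qprod_conv[OF Q' Q_def] qprod_conv[OF c1 Q_def]
        qprod_conv[OF c3 Q_def])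
  \<comment> \<open>The last factor has exponent t + dM = n; this is the source of [n] in the closed
    form.\<close>
  also have "qprod d t (Suc M) = qprod d t M * (1 - qvar powi n)"
    by (simp only: qprod_Suc n)
  also have "int d - t - n = int d - 2 * t - int d * int M" by (simp add: n)
  also have "int d - n = int d - t - int d * int M" by (simp add: n)
  also have "qprod d t M * (1 - qvar powi n) * qprod d (int d - 2 * t - int d * int M) M
      / (qprod d (int d - t - int d * int M) M * qprod d (int d) M)
    = qprod d (2 * t) M / qprod d (int d) M * (1 - qvar powi n)
      * ((\<Prod>i<M. - (qvar powi (- (2 * t + int d * int i)))) / (\<Prod>i<M. - (qvar powi (- (t + int d * int i)))))"
    unfolding qprod_reversal_neg using qprod_nonzero[of M t d] t' by (simp add: mult_ac)
  \<comment> \<open>The two reversals have the same signs, and each pair of factors leaves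
    q^(-t).\<close>
  also have "(\<Prod>i<M. - (qvar powi (- (2 * t + int d * int i)))) / (\<Prod>i<M. - (qvar powi (- (t + int d * int i))))
      = (\<Prod>i<M. qvar powi (- t))"
    unfolding prod_dividef[symmetric]
  proof (rule prod.cong)
    fix i
    have "- (2 * t + int d * int i) - - (t + int d * int i) = - t" by simp
    then show "- (qvar powi (- (2 * t + int d * int i))) / - (qvar powi (- (t + int d * int i)))
      = qvar powi (- t)"
      by (simp only: minus_divide_divide qvar_powi_divide)
  qed simp
  also have "\<dots> = qvar powi (- (t * int M))"
    using power_int_mult[of qvar "- t" "int M"] by simp
  finally show ?thesis .
qed

subsection \<open>Comparing the sum with its perturbation\<close>

text \<open>First-order expansion in \<delta>: every product of two or more terms \<delta> x_j lies
  in the square of the ideal containing \<delta>.\<close>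

lemma prod_one_minus_cong:
  fixes k :: nat
  assumes "\<delta> \<in> loc_ideal P i" "\<And>j. j < k \<Longrightarrow> x j \<in> loc_ideal P 0"
  shows "(\<Prod>j<k. 1 - \<delta> * x j) - (1 - \<delta> * (\<Sum>j<k. x j)) \<in> loc_ideal P (i + i)"
  using assms(2)
proof (induction k)
  case 0
  then show ?case by (simp add: loc_ideal_0)
next
  case (Suc k)
  let ?p = "\<Prod>j<k. 1 - \<delta> * x j" and ?s = "\<Sum>j<k. x j"
  have "(\<Prod>j<Suc k. 1 - \<delta> * x j) - (1 - \<delta> * (\<Sum>j<Suc k. x j))
      = (?p - (1 - \<delta> * ?s)) * (1 - \<delta> * x k) + \<delta> * \<delta> * (?s * x k)"
    by (simp add: algebra_simps)
  also have "\<dots> \<in> loc_ideal P (i + i)"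
    using Suc loc_ideal_mono[OF assms(1), of 0]
    by (intro loc_ideal_add loc_ideal_mult_right[OF Suc.IH] loc_ideal_mult_right[of "\<delta> * \<delta>"]
        loc_ideal_mult[OF assms(1) assms(1)] loc_ideal_diff loc_ideal_1 loc_ideal_mult_left loc_ideal_sum) auto
  finally show ?case .
qed

lemma divide_one_minus_cong:
  assumes "\<delta> \<in> loc_ideal P i" "X \<in> loc_ideal P 0" "Y \<in> loc_ideal P 0" "D \<in> loc_unit P"
    and N: "N - (1 - \<delta> * X) \<in> loc_ideal P (i + i)" and D: "D - (1 - \<delta> * Y) \<in> loc_ideal P (i + i)"
  shows "N / D - (1 - \<delta> * (X - Y)) \<in> loc_ideal P (i + i)"
proof -
  have "N / D - (1 - \<delta> * (X - Y))
      = ((N - (1 - \<delta> * X)) - (D - (1 - \<delta> * Y)) * (1 - \<delta> * (X - Y)) - \<delta> * \<delta> * (Y * (X - Y))) / D"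
    using loc_unit_nonzero[OF assms(4)] by (simp add: field_simps)
  moreover have "1 - \<delta> * (X - Y) \<in> loc_ideal P 0"
    using assms(2,3) loc_ideal_mono[OF assms(1), of 0]
    by (intro loc_ideal_diff loc_ideal_1 loc_ideal_mult_left) auto
  then have "(D - (1 - \<delta> * Y)) * (1 - \<delta> * (X - Y)) \<in> loc_ideal P (i + i)"
    by (rule loc_ideal_mult_right[OF D])
  moreover have "\<delta> * \<delta> * (Y * (X - Y)) \<in> loc_ideal P (i + i)"
    using assms(2,3) by (intro loc_ideal_mult_right[OF loc_ideal_mult[OF assms(1,1)]]
        loc_ideal_mult_left loc_ideal_diff)
  ultimately show ?thesis
    using N assms(4) by (simp only: loc_ideal_divide_unit loc_ideal_diff)
qed

text \<open>The coefficient in (1 - x q^e)(1 - q^e/x) = (1 - q^e)^2 (1 - \<delta> h) with \<delta> =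
  x + 1/x - 2, that is, minus the logarithmic derivative of this pair at \<delta> = 0.\<close>

definition hfun :: "int \<Rightarrow> ratfun" where
  "hfun e = qvar powi e / (1 - qvar powi e)\<^sup>2"

lemma hfun_minus: "hfun (- e) = hfun e"
proof -
  have "qvar powi (- e) * qvar powi e = 1" by (simp add: power_int_minus)
  moreover have "a / (- a * y)\<^sup>2 = b / y\<^sup>2" if "a * b = 1" for a b y :: ratfun
  proof -
    have "a \<noteq> 0" using that by auto
    then have "a / (- a * y)\<^sup>2 = a * b / (a * y\<^sup>2)" using that by (simp add: power2_eq_square)
    then show ?thesis using \<open>a \<noteq> 0\<close> by simp
  qed
  ultimately show ?thesis
    unfolding hfun_def one_minus_qvar_powi_uminus by blast
qed

lemma qvar_shift_pair:
  assumes "e \<noteq> 0"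
  shows "(1 - qvar powi (e + n)) * (1 - qvar powi (e - n))
    = (1 - qvar powi e)\<^sup>2 * (1 - (qvar powi n + qvar powi (- n) - 2) * hfun e)"
proof -
  have inv: "qvar powi n * qvar powi (- n) = 1" by (simp add: power_int_minus)
  have nz: "1 - qvar powi e \<noteq> 0" using assms by simp
  have "(1 - qvar powi e)\<^sup>2 * (1 - (qvar powi n + qvar powi (- n) - 2) * hfun e)
      = (1 - qvar powi e)\<^sup>2 - (qvar powi n + qvar powi (- n) - 2) * qvar powi e"
    using nz by (simp add: hfun_def right_diff_distrib)
  moreover have "(1 - x * a) * (1 - x * b) = (1 - x)\<^sup>2 - (a + b - 2) * x" if "a * b = 1" for a b x :: ratfun
    using that by algebra
  moreover have "qvar powi (e + n) = qvar powi e * qvar powi n"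
    "qvar powi (e - n) = qvar powi e * qvar powi (- n)"
    by (simp_all only: qvar_powi_mult diff_conv_add_uminus)
  ultimately show ?thesis using inv by simp
qed

lemma qprod_shift_pair:
  assumes "\<And>j. j < k \<Longrightarrow> s + int d * int j \<noteq> 0"
  shows "qprod d (s + n) k * qprod d (s - n) k = qprod d s k ^ 2
    * (\<Prod>j<k. 1 - (qvar powi n + qvar powi (- n) - 2) * hfun (s + int d * int j))"
proof -
  have "qprod d (s + n) k * qprod d (s - n) k
      = (\<Prod>j<k. (1 - qvar powi (s + int d * int j + n)) * (1 - qvar powi (s + int d * int j - n)))"
    unfolding qprod_def prod.distrib[symmetric] by (simp add: algebra_simps)
  also have "\<dots> = (\<Prod>j<k. (1 - qvar powi (s + int d * int j))\<^sup>2
      * (1 - (qvar powi n + qvar powi (- n) - 2) * hfun (s + int d * int j)))"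
    using assms by (intro prod.cong qvar_shift_pair) auto
  finally show ?thesis by (simp only: qprod_def prod.distrib prod_power_distrib)
qed

lemma wp_term_shift_eq:
  assumes "d > 0" "\<And>j. j < k \<Longrightarrow> t + int d * int j \<noteq> 0"
  defines "\<delta> n \<equiv> qvar powi n + qvar powi (- n) - 2"
  shows "wp_term_shift d t n k = wp_term d t k
    * ((\<Prod>j<k. 1 - \<delta> n * hfun (t + int d * int j)) / (\<Prod>j<k. 1 - \<delta> n * hfun (int d + int d * int j)))"
proof -
  let ?X = "\<Prod>j<k. 1 - \<delta> n * hfun (t + int d * int j)"
  let ?Y = "\<Prod>j<k. 1 - \<delta> n * hfun (int d + int d * int j)"
  have pos: "int d + int d * int j \<noteq> 0" for j
    using assms(1) by (simp add: add_pos_nonneg less_imp_neq[symmetric])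
  have X: "qprod d (t + n) k * qprod d (t - n) k = qprod d t k ^ 2 * ?X"
    unfolding \<delta>_def by (intro qprod_shift_pair assms)
  have Y: "qprod d (int d - n) k * qprod d (int d + n) k = qprod d (int d) k ^ 2 * ?Y"
    unfolding \<delta>_def mult.commute[of "qprod d (int d - n) k"] by (intro qprod_shift_pair pos)
  have "qprod d t k ^ 2 * qprod d (t + n) k * qprod d (t - n) k
      / (qprod d (int d) k ^ 2 * qprod d (int d - n) k * qprod d (int d + n) k)
    = (qprod d t k / qprod d (int d) k) ^ 4 * (?X / ?Y)"
    unfolding mult.assoc X Y by (simp add: power_divide flip: mult.assoc power_add)
  then show ?thesis unfolding wp_term_shift_def wp_term_def by (simp only: mult_ac)
qed

section \<open>First-order term of the perturbation modulo the n-th cyclotomic polynomial\<close>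

context
  fixes n d M :: nat and t :: int
  assumes n: "n > 1" and d: "coprime n d" "d > 0" and M: "M < n" "int n = t + int d * int M"
    and t: "\<not> int d dvd t"
begin

private abbreviation (input) "J \<equiv> loc_ideal (cyclotomic n)"

private lemma t_nonzero: "t + int d * i \<noteq> 0"
  using t by (metis add.commute add_diff_cancel_right' dvd_0_right dvd_add_right_iff dvd_triv_left)

private lemma not_dvd_mult: "0 < j \<Longrightarrow> j < n \<Longrightarrow> \<not> int n dvd int d * int j"
  using coprime_dvd_mult_right_iff[OF d(1), of j]
  by (metis dvd_imp_le int_dvd_int_iff not_le of_nat_mult)

private lemma not_dvd_base: "j < M \<Longrightarrow> \<not> int n dvd int d + int d * int j"
  using not_dvd_mult[of "Suc j"] M(1) by (simp add: distrib_left)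

private lemma not_dvd_neg: "j < M \<Longrightarrow> \<not> int n dvd - (int d * int (M - j))"
  using not_dvd_mult[of "M - j"] M(1) by simp

private lemma t_cong: "j < M \<Longrightarrow> t + int d * int j - - (int d * int (M - j)) = int n"
  using M(2) by (simp add: of_nat_diff algebra_simps)

private lemma not_dvd_t: "j < M \<Longrightarrow> \<not> int n dvd t + int d * int j"
  using not_dvd_neg[of j] t_cong[of j] by (metis diff_add_cancel dvd_add_right_iff dvd_refl)

lemma hfun_integral: "\<not> int n dvd e \<Longrightarrow> hfun e \<in> J 0"
  unfolding hfun_def
  by (intro loc_ideal_divide_unit loc_unit_power one_minus_qvar_powi_unit[OF n]
      loc_unit_ideal[OF qvar_powi_unit[OF n]])

lemma hfun_cong:
  assumes "\<not> int n dvd e" "\<not> int n dvd f" "int n dvd e - f"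
  shows "hfun e - hfun f \<in> J 1"
  unfolding hfun_def
proof (intro loc_ideal_divide_cong loc_ideal_power_cong loc_unit_power
    one_minus_qvar_powi_unit[OF n] one_minus_qvar_powi_integral[OF n]
    loc_unit_ideal[OF qvar_powi_unit[OF n]] assms)
  show c: "qvar powi e - qvar powi f \<in> J 1" by (rule qvar_powi_cong[OF n assms(3)])
  show "1 - qvar powi e - (1 - qvar powi f) \<in> J 1" using loc_ideal_uminus[OF c] by simp
qed

text \<open>As \<open>hfun\<close> is even, the first sum runs over the exponents d(M-k+1), ..., dM
  and the second over d, ..., d(M-k); together they give the full range.\<close>

lemma hfun_sum_reflect:
  assumes "k \<le> M"
  shows "(\<Sum>j<k. hfun (- (int d * int (M - j)))) + (\<Sum>j<M - k. hfun (int d + int d * int j))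
    = (\<Sum>j<M. hfun (int d + int d * int j))"
  using assms
proof (induction k)
  case (Suc k)
  have "M - k = Suc (M - Suc k)" using Suc.prems by simp
  moreover have "int d + int d * int (M - Suc k) = int d * int (M - k)"
    using Suc.prems by (simp add: of_nat_diff algebra_simps)
  then have "hfun (int d + int d * int (M - Suc k)) = hfun (- (int d * int (M - k)))"
    by (simp only: hfun_minus)
  ultimately show ?case using Suc by simp
qed simp

text \<open>Up to sign, this sum is the derivative at \<open>\<delta> = 0\<close> of the perturbed sum.\<close>

lemma wp_weighted_sum:
  "(\<Sum>k\<le>M. wp_term d t k
      * ((\<Sum>j<k. hfun (t + int d * int j)) - (\<Sum>j<k. hfun (int d + int d * int j)))) \<in> J 1"
proof -
  define Y where "Y k = (\<Sum>j<k. hfun (int d + int d * int j))" for k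
  define A where "A k = wp_term d (- (int d * int M)) k" for k
  define S where "S k = (\<Sum>j<k. hfun (- (int d * int (M - j)))) - Y k" for k
  have r: "int n dvd t + int d * int M" using M(2) by (metis dvd_refl)
  have Y: "Y k \<in> J 0" if "k \<le> M" for k
    unfolding Y_def using that by (intro loc_ideal_sum hfun_integral not_dvd_base) auto
  have "wp_term d t k * ((\<Sum>j<k. hfun (t + int d * int j)) - Y k) - A k * S k \<in> J 1" if k: "k \<le> M" for k
  proof (rule loc_ideal_mult_cong)
    show "wp_term d t k - A k \<in> J 1"
      using wp_term_reduce[OF n d M(1) r k, of 0] by (simp add: A_def)
    show "wp_term d t k \<in> J 0" by (rule wp_term_integral[OF n d])
    show "S k \<in> J 0"
      unfolding S_def using k
      by (intro loc_ideal_diff Y loc_ideal_sum hfun_integral not_dvd_neg) auto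
    have "(\<Sum>j<k. hfun (t + int d * int j)) - (\<Sum>j<k. hfun (- (int d * int (M - j)))) \<in> J 1"
      unfolding sum_subtractf[symmetric]
    proof (rule loc_ideal_sum)
      fix j assume "j \<in> {..<k}"
      then have j: "j < M" using k by simp
      have "int n dvd t + int d * int j - - (int d * int (M - j))" unfolding t_cong[OF j] by simp
      with not_dvd_t[OF j] not_dvd_neg[OF j]
      show "hfun (t + int d * int j) - hfun (- (int d * int (M - j))) \<in> J 1"
        by (rule hfun_cong)
    qed
    then show "((\<Sum>j<k. hfun (t + int d * int j)) - Y k) - S k \<in> J 1"
      by (simp add: S_def)
  qed
  then have "(\<Sum>k\<le>M. wp_term d t k * ((\<Sum>j<k. hfun (t + int d * int j)) - Y k) - A k * S k) \<in> J 1"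
    by (intro loc_ideal_sum) auto
  \<comment> \<open>After reduction the cancellation is exact: under k to M - k the term
    \<open>A\<close> changes sign, while S k = Y M - Y (M - k) - Y k is fixed.\<close>
  moreover have "(\<Sum>k\<le>M. A k * S k) = 0"
  proof -
    have S: "S k = Y M - Y (M - k) - Y k" if "k \<le> M" for k
      using hfun_sum_reflect[OF that] by (simp add: S_def Y_def algebra_simps)
    have A: "A (M - k) = - A k" if "k \<le> M" for k
      unfolding A_def using wp_term_antisymmetric[OF that d(2)] .
    have "(\<Sum>k\<le>M. A k * S k) = (\<Sum>k\<le>M. A (M - k) * S (M - k))"
      by (rule sum.reindex_bij_witness[of _ "\<lambda>k. M - k" "\<lambda>k. M - k"]) auto
    also have "\<dots> = - (\<Sum>k\<le>M. A k * S k)"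
      unfolding sum_negf[symmetric]
      by (rule sum.cong) (simp_all add: A S algebra_simps)
    finally have "2 * (\<Sum>k\<le>M. A k * S k) = 0" by simp
    then show ?thesis using loc_unit_nonzero[OF two_loc_unit] by simp
  qed
  ultimately show ?thesis by (simp add: sum_subtractf Y_def)
qed

text \<open>As \<delta> lies in \<open>J 2\<close>, the quadratic error lies in \<open>J 4\<close>.
  The linear term is \<delta> times the weighted sum, which lies in \<open>J 1\<close>, and so
  belongs to \<open>J 3\<close>.\<close>

lemma wp_sum_diff_shift:
  "(\<Sum>k\<le>M. wp_term d t k) - (\<Sum>k\<le>M. wp_term_shift d t (int n) k) \<in> J 3"
proof -
  define \<delta> where "\<delta> = qvar powi int n + qvar powi (- int n) - 2"
  have "\<delta> = (1 - qvar powi int n)\<^sup>2 * qvar powi (- int n)"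
  proof -
    have "qvar powi int n * qvar powi (- int n) = 1" by (simp add: power_int_minus)
    moreover have "a + b - 2 = (1 - a)\<^sup>2 * b" if "a * b = 1" for a b :: ratfun
      using that by algebra
    ultimately show ?thesis unfolding \<delta>_def by blast
  qed
  moreover have "(1 - qvar powi int n)\<^sup>2 \<in> J 2"
    using loc_ideal_power[OF one_minus_qvar_powi_ideal[OF n dvd_refl], of 2] by simp
  ultimately have \<delta>: "\<delta> \<in> J 2"
    by (simp add: loc_ideal_mult_right loc_unit_ideal[OF qvar_powi_unit[OF n]] del: power_int_of_nat)
  let ?X = "\<lambda>k. \<Sum>j<k. hfun (t + int d * int j)"
  let ?Y = "\<lambda>k. \<Sum>j<k. hfun (int d + int d * int j)"
  define \<rho> where "\<rho> k = (\<Prod>j<k. 1 - \<delta> * hfun (t + int d * int j))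
    / (\<Prod>j<k. 1 - \<delta> * hfun (int d + int d * int j))" for k
  have \<rho>: "\<rho> k - (1 - \<delta> * (?X k - ?Y k)) \<in> J (2 + 2)" if k: "k \<le> M" for k
    unfolding \<rho>_def
  proof (rule divide_one_minus_cong[OF \<delta>])
    show "?X k \<in> J 0" using k by (intro loc_ideal_sum hfun_integral not_dvd_t) auto
    show "?Y k \<in> J 0" using k by (intro loc_ideal_sum hfun_integral not_dvd_base) auto
    show "(\<Prod>j<k. 1 - \<delta> * hfun (t + int d * int j)) - (1 - \<delta> * ?X k) \<in> J (2 + 2)"
      using k by (intro prod_one_minus_cong[OF \<delta>] hfun_integral not_dvd_t) auto
    show "(\<Prod>j<k. 1 - \<delta> * hfun (int d + int d * int j)) - (1 - \<delta> * ?Y k) \<in> J (2 + 2)"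
      using k by (intro prod_one_minus_cong[OF \<delta>] hfun_integral not_dvd_base) auto
    show "(\<Prod>j<k. 1 - \<delta> * hfun (int d + int d * int j)) \<in> loc_unit (cyclotomic n)"
    proof (rule loc_unit_prod)
      fix j assume "j \<in> {..<k}"
      then have j: "\<not> int n dvd int d + int d * int j" using k not_dvd_base by simp
      let ?e = "int d + int d * int j"
      have e: "?e \<noteq> 0" using j by (metis dvd_0_right)
      \<comment> \<open>Undoing the shift identity writes the factor as a quotient of 1 - q^(e+n), 1
        - q^(e-n) and 1 - q^e, whose exponents are all prime to divisibility by n, so each is a
        unit.\<close>
      have "1 - \<delta> * hfun ?e
          = (1 - qvar powi (?e + int n)) * (1 - qvar powi (?e - int n)) / (1 - qvar powi ?e)\<^sup>2"
        unfolding qvar_shift_pair[OF e] \<delta>_def[symmetric] using e by simp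
      also have "\<dots> \<in> loc_unit (cyclotomic n)"
      proof (intro loc_unit_divide loc_unit_mult loc_unit_power one_minus_qvar_powi_unit[OF n] j)
        show "\<not> int n dvd ?e + int n" using j by (metis add.commute dvd_add_right_iff dvd_refl)
        show "\<not> int n dvd ?e - int n" using j by (metis diff_add_cancel dvd_add_left_iff dvd_refl)
      qed
      finally show "1 - \<delta> * hfun ?e \<in> loc_unit (cyclotomic n)" .
    qed
  qed
  have "wp_term_shift d t (int n) k = wp_term d t k * \<rho> k" for k
    unfolding \<rho>_def \<delta>_def by (rule wp_term_shift_eq[OF d(2) t_nonzero])
  then have "(\<Sum>k\<le>M. wp_term d t k) - (\<Sum>k\<le>M. wp_term_shift d t (int n) k)
      = (\<Sum>k\<le>M. \<delta> * (wp_term d t k * (?X k - ?Y k)) - wp_term d t k * (\<rho> k - (1 - \<delta> * (?X k - ?Y k))))"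
    unfolding sum_subtractf[symmetric] by (intro sum.cong) (simp_all add: algebra_simps)
  also have "\<dots> = \<delta> * (\<Sum>k\<le>M. wp_term d t k * (?X k - ?Y k))
      - (\<Sum>k\<le>M. wp_term d t k * (\<rho> k - (1 - \<delta> * (?X k - ?Y k))))"
    by (simp only: sum_subtractf sum_distrib_left)
  also have "\<dots> \<in> J 3"
  proof (rule loc_ideal_diff)
    show "\<delta> * (\<Sum>k\<le>M. wp_term d t k * (?X k - ?Y k)) \<in> J 3"
      using loc_ideal_mult[OF \<delta> wp_weighted_sum] by simp
    show "(\<Sum>k\<le>M. wp_term d t k * (\<rho> k - (1 - \<delta> * (?X k - ?Y k)))) \<in> J 3"
    proof (intro loc_ideal_sum loc_ideal_mult_left wp_term_integral[OF n d])
      fix k assume "k \<in> {..M}"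
      then show "\<rho> k - (1 - \<delta> * (?X k - ?Y k)) \<in> J 3"
        by (intro loc_ideal_mono[OF \<rho>]) auto
    qed
  qed
  finally show ?thesis .
qed

end

subsection \<open>The supercongruence\<close>

lemma wp_closed_form_divisible:
  assumes "m > 1" "coprime m d" "d > 0" "m dvd n"
  shows "qprod d (2 * t) M / qprod d (int d) M * (1 - qvar powi int n) * qvar powi e
    \<in> loc_ideal (cyclotomic m) 1"
proof -
  have "int m dvd int n" using assms(4) by simp
  then show ?thesis
    by (intro loc_ideal_mult_right[of _ _ 1] loc_ideal_mult_left qprod_ratio_integral assms
        one_minus_qvar_powi_ideal loc_unit_ideal qvar_powi_unit)
qed

text \<open>At e = n the sum up to M is compared with its perturbation, and any terms beyond M lie
  in the fourth power of the ideal. At other divisors e both sides vanish separately to first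
  order.\<close>

lemma wp_sum_congruence:
  fixes n d M K :: nat and t :: int
  assumes n: "n > 1" and d: "coprime n d" "d > 0" and M: "M < n" "int n = t + int d * int M"
    and t: "\<not> int d dvd t" and K: "K = M \<or> K = n - 1" and e: "e dvd n" "e \<noteq> 1"
  shows "(\<Sum>k\<le>K. wp_term d t k)
      - qprod d (2 * t) M / qprod d (int d) M * (1 - qvar powi int n) * qvar powi (- (t * int M))
    \<in> loc_ideal (cyclotomic e) (if e = n then 3 else 1)"
proof (cases "e = n")
  case True
  have "(\<Sum>k\<le>K. wp_term d t k)
      = (\<Sum>k\<in>{..K} - {..M}. wp_term d t k) + (\<Sum>k\<le>M. wp_term d t k)"
    using K M(1) by (intro sum.subset_diff) auto
  moreover have "(\<Sum>k\<in>{..K} - {..M}. wp_term d t k) \<in> loc_ideal (cyclotomic n) 3"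
  proof (rule loc_ideal_sum)
    fix k assume "k \<in> {..K} - {..M}"
    then have "M < k mod n" using K M(1) by auto
    moreover have "int n dvd t + int d * int M" using M(2) by (metis dvd_refl)
    ultimately have "wp_term d t k \<in> loc_ideal (cyclotomic n) 4"
      using wp_term_divisible[OF n d M(1)] by blast
    then show "wp_term d t k \<in> loc_ideal (cyclotomic n) 3" by (rule loc_ideal_mono) simp
  qed
  ultimately show ?thesis
    using loc_ideal_add wp_sum_diff_shift[OF n d M t]
    unfolding True sum_wp_term_shift[OF M(2) d(2) t] by (fastforce simp: add_diff_eq)
next
  case False
  have "e > 0" using e(1) n by (auto intro!: Nat.gr0I)
  then have e1: "e > 1" using e(2) by simp
  have de: "coprime e d" using e(1) d(1) by (rule coprime_divisors[OF _ dvd_refl])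
  \<comment> \<open>Since t + dM = n is divisible by e, the residue of M is the root of t + dr
    modulo e.\<close>
  define r where "r = M mod e"
  have r: "r < e" using e1 by (simp add: r_def)
  have "t + int d * int r = int n - int e * (int d * int (M div e))"
  proof -
    have "int M = int e * int (M div e) + int r"
      unfolding r_def by (metis mult_div_mod_eq of_nat_add of_nat_mult)
    then show ?thesis by (simp add: M(2) algebra_simps)
  qed
  then have dvd: "int e dvd t + int d * int r" using e(1) by simp
  \<comment> \<open>For K = M this is an equality; for K = n - 1 the residue is e - 1, the largest
    possible.\<close>
  have "r \<le> K mod e"
    using K
  proof
    assume "K = n - 1"
    obtain c where c: "n = e * c" using e(1) by auto
    with n have "c > 0" by (auto intro: Nat.gr0I)
    then have "n - 1 = e - 1 + e * (c - 1)"
      using e1 by (simp add: c algebra_simps)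
    then have "(n - 1) mod e = (e - 1) mod e" by (simp only: mod_mult_self2)
    then have "(n - 1) mod e = e - 1" using e1 by simp
    then show ?thesis using r \<open>K = n - 1\<close> by simp
  qed (simp add: r_def)
  from wp_sum_divisible[OF e1 de d(2) r dvd this]
  have "(\<Sum>k\<le>K. wp_term d t k) \<in> loc_ideal (cyclotomic e) 1" .
  then show ?thesis
    unfolding if_not_P[OF False]
    by (rule loc_ideal_diff) (rule wp_closed_form_divisible[OF e1 de d(2) e(1)])
qed

text \<open>The modulus is the product of the cyclotomic polynomials of the divisors e > 1 of n,
  with exponent 3 at e = n and 1 elsewhere. These are pairwise coprime, so the local memberships
  combine.\<close>

lemma qcong_of_loc_ideal:
  assumes n: "n > 0"
    and x: "\<And>e. e dvd n \<Longrightarrow> e \<noteq> 1 \<Longrightarrow> A - B \<in> loc_ideal (cyclotomic e) (if e = n then 3 else 1)"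
    and "n \<noteq> 1"
  shows "qcong A B (qint_poly n * cyclotomic n ^ 2)"
proof -
  let ?E = "{e. e dvd n \<and> e \<noteq> 1}"
  have fin: "finite ?E" using n by simp
  have pos: "e > 0" if "e dvd n" for e using that n by (auto intro!: Nat.gr0I)
  have "qint_poly n * cyclotomic n ^ 2
      = (\<Prod>e\<in>?E. cyclotomic e) * (\<Prod>e\<in>?E. if e = n then cyclotomic e ^ 2 else 1)"
    using fin \<open>n \<noteq> 1\<close> by (simp add: qint_poly_eq_prod[OF n])
  also have "\<dots> = (\<Prod>e\<in>?E. cyclotomic e ^ (if e = n then 3 else 1))"
    unfolding prod.distrib[symmetric]
    by (intro prod.cong) (simp_all add: power2_eq_square power3_eq_cube)
  finally have eq: "qint_poly n * cyclotomic n ^ 2 = (\<Prod>e\<in>?E. cyclotomic e ^ (if e = n then 3 else 1))" .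
  obtain N D where "D \<noteq> 0" "coprime D (\<Prod>e\<in>?E. cyclotomic e ^ (if e = n then 3 else 1))"
    "(\<Prod>e\<in>?E. cyclotomic e ^ (if e = n then 3 else 1)) dvd N" "A - B = Fract N D"
  proof (rule loc_ideal_prod_coprime[OF fin])
    show "A - B \<in> loc_ideal (cyclotomic e) (if e = n then 3 else 1)" if "e \<in> ?E" for e
      using x that by simp
    show "coprime (cyclotomic a) (cyclotomic b)" if "a \<in> ?E" "b \<in> ?E" "a \<noteq> b" for a b
      using that pos by (intro coprime_cyclotomic_cyclotomic) auto
  qed
  then show ?thesis unfolding qcong_def eq by blast
qed

theorem theorem5:
  fixes n d :: nat and t :: int
  assumes "n > 1" and "d \<ge> 2"
    and "coprime t (int d)"
    and "[int n = t] (mod int d)"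
    and "int n + int d - int n * int d \<le> t" and "t \<le> int n"
  shows
    "qcong
       (\<Sum>k\<le>nat ((int n - t) div int d).
          qint (2 * int d * int k + t)
          * qpoch (qvar powi t) (qvar ^ d) k ^ 4 / qpoch (qvar ^ d) (qvar ^ d) k ^ 4
          * qvar powi ((int d - 2 * t) * int k))
       (qpoch (qvar powi (2 * t)) (qvar ^ d) (nat ((int n - t) div int d))
          / qpoch (qvar ^ d) (qvar ^ d) (nat ((int n - t) div int d))
          * qint (int n) * qvar powi (t * (t - int n) div int d))
       (qint_poly n * cyclotomic n ^ 2)
   \<and>
    qcong
       (\<Sum>k\<le>n - 1.
          qint (2 * int d * int k + t)
          * qpoch (qvar powi t) (qvar ^ d) k ^ 4 / qpoch (qvar ^ d) (qvar ^ d) k ^ 4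
          * qvar powi ((int d - 2 * t) * int k))
       (qpoch (qvar powi (2 * t)) (qvar ^ d) (nat ((int n - t) div int d))
          / qpoch (qvar ^ d) (qvar ^ d) (nat ((int n - t) div int d))
          * qint (int n) * qvar powi (t * (t - int n) div int d))
       (qint_poly n * cyclotomic n ^ 2)"
proof -
  define M where "M = nat ((int n - t) div int d)"
  have d: "d > 0" using assms(2) by simp
  have "int d dvd int n - t" using assms(4) by (simp add: cong_iff_dvd_diff)
  moreover have "(int n - t) div int d \<ge> 0" using assms(6) d by (simp add: pos_imp_zdiv_nonneg_iff)
  ultimately have M: "int n - t = int d * int M" by (simp add: M_def)
  then have M2: "int n = t + int d * int M" by simp
  \<comment> \<open>This is the lower bound on t rewritten through n - t = dM; it yields M <
    n.\<close>
  have "int d * int M \<le> int d * (int n - 1)" using assms(5) M by (simp add: algebra_simps)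
  then have "int M \<le> int n - 1" using d by (subst (asm) mult_le_cancel_left_pos) auto
  then have M1: "M < n" by simp
  have "coprime (int n) (int d)" using assms(3,4) cong_imp_coprime cong_sym by blast
  then have nd: "coprime n d" by simp
  have td: "\<not> int d dvd t"
  proof
    assume "int d dvd t"
    with assms(3) have "int d dvd 1" using coprime_common_divisor[of t "int d" "int d"] by simp
    then show False using assms(2) by simp
  qed
  have exponent: "t * (t - int n) div int d = - (t * int M)"
  proof -
    have "t * (t - int n) = int d * (- (t * int M))" using M by (simp add: algebra_simps)
    moreover have "int d * x div int d = x" for x using d by simp
    ultimately show ?thesis by (simp only:)
  qed
  have poch: "qpoch (qvar powi s) (qvar ^ d) k = qprod d s k"
    "qpoch (qvar ^ d) (qvar ^ d) k = qprod d (int d) k" for s k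
    unfolding qpoch_def by (simp_all add: qprod_conv[OF _ refl])
  have "qcong
       (\<Sum>k\<le>K. qint (2 * int d * int k + t)
          * qpoch (qvar powi t) (qvar ^ d) k ^ 4 / qpoch (qvar ^ d) (qvar ^ d) k ^ 4
          * qvar powi ((int d - 2 * t) * int k))
       (qpoch (qvar powi (2 * t)) (qvar ^ d) M / qpoch (qvar ^ d) (qvar ^ d) M
          * qint (int n) * qvar powi (t * (t - int n) div int d))
       (qint_poly n * cyclotomic n ^ 2)" (is "qcong ?A ?B _")
    if K: "K = M \<or> K = n - 1" for K
  proof (rule qcong_of_loc_ideal)
    fix e assume e: "e dvd n" "e \<noteq> 1"
    have "e \<noteq> 0" using e(1) assms(1) by (intro notI) simp
    with e(2) have e1: "e > 1" by simp
    have summand: "qint (2 * int d * int k + t)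
          * qpoch (qvar powi t) (qvar ^ d) k ^ 4 / qpoch (qvar ^ d) (qvar ^ d) k ^ 4
          * qvar powi ((int d - 2 * t) * int k) = wp_term d t k / (1 - qvar)" for k
      by (simp add: qint_def poch wp_term_def power_divide add.commute)
    \<comment> \<open>The common denominator 1 - q is written with \<open>powi 1\<close> so that the
      unit criterion applies; it is a unit because e > 1 does not divide 1.\<close>
    have diff: "?A - ?B = ((\<Sum>k\<le>K. wp_term d t k)
      - qprod d (2 * t) M / qprod d (int d) M * (1 - qvar powi int n) * qvar powi (- (t * int M)))
        / (1 - qvar powi 1)"
      unfolding summand unfolding poch exponent qint_def sum_divide_distrib[symmetric]
        diff_divide_distrib[of "\<Sum>k\<le>K. wp_term d t k"] by simp
    show "?A - ?B \<in> loc_ideal (cyclotomic e) (if e = n then 3 else 1)"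
      unfolding diff using e1
      by (intro loc_ideal_divide_unit wp_sum_congruence assms(1) nd d M1 M2 td K e
          one_minus_qvar_powi_unit) auto
  qed (use assms(1) in auto)
  then show ?thesis unfolding M_def by blast
qed

end
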